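(* Let $k$ be a field, let $T$ be a tree with $t$ vertices and let $S$ be an independent set in $T$ (a set of pairwise non-adjacent vertices) of size $s$. Let $W_T(S)$ be the subset of $X_T^{\mathtt{versal}}$ where $x_u=0$ for all $u\in S$ and $x_u\neq0$ for all $u\notin S$. There is an isomorphism $$W_T(S)\simeq(\mathbb{G}_m)^{t+\dim(T)-2s}\times(\mathbb{A}^1)^s.$$
   Context: A tree is a finite connected simply-connected graph. A vertex cover of a tree $T$ is a set of vertices meeting every edge; a minimum vertex cover is one of minimal cardinality. Canonical coloring: a vertex of $T$ is green if it lies in all minimum vertex covers, orange if it lies in some but not all, red if it lies in none. The dimension $\dim(T)$ is the number of red vertices minus the number of green vertices of $T$. A matching of $T$ is a set of edges such that every vertex lies in at most one of them; a maximum matching is one of maximal cardinality. Known fact: $\dim(T)$ is the number of vertices not covered by any given maximum matching, and these vertices are red. Choose a maximum matching $M$ of $T$. $X_T^{\mathtt{versal}}$ is the affine scheme over $k$ with variables $x_i,x'_i$ for all vertices $i$ of $T$ and $\alpha_i$ for all vertices $i$ not covered by $M$, defined by the equations $x_ix'_i=1+\alpha_i\prod_jx_j$ for all vertices $i$ (product over the vertices $j$ adjacent to $i$) and the condition that all variables $\alpha_i$ are invertible; here $\alpha_i=1$ whenever $i$ is covered by $M$. Different choices of $M$ lead to isomorphic varieties, by isomorphisms rescaling the variables $x_i$, $x'_i$ by invertible functions, hence compatible with the sets $W_T(S)$. $\mathbb{G}_m$ is the multiplicative group and $\mathbb{A}^1$ the affine line over $k$. *)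

theory Defs
  imports "HOL-Algebra.QuotRing" "HOL-Library.Poly_Mapping"
begin

section \<open>Trees, canonical coloring, matchings\<close>

definition simple_graph :: "'v set \<Rightarrow> 'v set set \<Rightarrow> bool" where
  "simple_graph V E \<longleftrightarrow> finite V \<and> (\<forall>e\<in>E. e \<subseteq> V \<and> card e = 2)"

definition connected_graph :: "'v set \<Rightarrow> 'v set set \<Rightarrow> bool" where
  "connected_graph V E \<longleftrightarrow>
     V \<noteq> {} \<and> (\<forall>u\<in>V. \<forall>v\<in>V. (u, v) \<in> {(a, b). {a, b} \<in> E}\<^sup>*)"

definition graph_cycle :: "'v set set \<Rightarrow> 'v list \<Rightarrow> bool" where
  "graph_cycle E p \<longleftrightarrow>
     3 \<le> length p \<and> distinct p \<and>
     (\<forall>i<length p. {p ! i, p ! (Suc i mod length p)} \<in> E)"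

text \<open>A finite graph is simply connected iff it is connected and has no cycle; loops and
  multiple edges would be cycles, so only simple graphs have to be considered.\<close>

definition tree :: "'v set \<Rightarrow> 'v set set \<Rightarrow> bool" where
  "tree V E \<longleftrightarrow> simple_graph V E \<and> connected_graph V E \<and> (\<nexists>p. graph_cycle E p)"

definition neighbors :: "'v set \<Rightarrow> 'v set set \<Rightarrow> 'v \<Rightarrow> 'v set" where
  "neighbors V E i = {j \<in> V. {i, j} \<in> E}"

definition independent_set :: "'v set \<Rightarrow> 'v set set \<Rightarrow> 'v set \<Rightarrow> bool" where
  "independent_set V E S \<longleftrightarrow> S \<subseteq> V \<and> (\<forall>u\<in>S. \<forall>v\<in>S. {u, v} \<notin> E)"

definition vertex_cover :: "'v set \<Rightarrow> 'v set set \<Rightarrow> 'v set \<Rightarrow> bool" where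
  "vertex_cover V E C \<longleftrightarrow> C \<subseteq> V \<and> (\<forall>e\<in>E. C \<inter> e \<noteq> {})"

definition min_vertex_cover :: "'v set \<Rightarrow> 'v set set \<Rightarrow> 'v set \<Rightarrow> bool" where
  "min_vertex_cover V E C \<longleftrightarrow>
     vertex_cover V E C \<and> (\<forall>D. vertex_cover V E D \<longrightarrow> card C \<le> card D)"

definition green :: "'v set \<Rightarrow> 'v set set \<Rightarrow> 'v set" where
  "green V E = {v \<in> V. \<forall>C. min_vertex_cover V E C \<longrightarrow> v \<in> C}"

definition red :: "'v set \<Rightarrow> 'v set set \<Rightarrow> 'v set" where
  "red V E = {v \<in> V. \<forall>C. min_vertex_cover V E C \<longrightarrow> v \<notin> C}"

definition tree_dim :: "'v set \<Rightarrow> 'v set set \<Rightarrow> int" where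
  "tree_dim V E = int (card (red V E)) - int (card (green V E))"

definition matching :: "'v set \<Rightarrow> 'v set set \<Rightarrow> 'v set set \<Rightarrow> bool" where
  "matching V E M \<longleftrightarrow>
     M \<subseteq> E \<and> (\<forall>v\<in>V. \<forall>e\<in>M. \<forall>f\<in>M. v \<in> e \<longrightarrow> v \<in> f \<longrightarrow> e = f)"

definition max_matching :: "'v set \<Rightarrow> 'v set set \<Rightarrow> 'v set set \<Rightarrow> bool" where
  "max_matching V E M \<longleftrightarrow>
     matching V E M \<and> (\<forall>N. matching V E N \<longrightarrow> card N \<le> card M)"


section \<open>Affine schemes given by variables, invertibility conditions and equations\<close>

text \<open>Monomials are finitely supported families of integer exponents.  For \<open>U \<subseteq> X\<close>,
  \<open>laurent_ring X U\<close> is the localization \<open>k[x | x \<in> X][1/u | u \<in> U]\<close> of the polynomial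
  ring: a negative exponent is allowed exactly on the variables in \<open>U\<close>.\<close>

type_synonym ('x, 'k) laurent = "('x \<Rightarrow>\<^sub>0 int) \<Rightarrow>\<^sub>0 'k"

definition var :: "'x \<Rightarrow> ('x, 'k::comm_ring_1) laurent" where
  "var x = Poly_Mapping.single (Poly_Mapping.single x 1) 1"

definition const :: "'k \<Rightarrow> ('x, 'k::comm_ring_1) laurent" where
  "const c = Poly_Mapping.single 0 c"

definition laurent_ring :: "'x set \<Rightarrow> 'x set \<Rightarrow> ('x, 'k::comm_ring_1) laurent ring" where
  "laurent_ring X U =
     \<lparr>carrier = {p. \<forall>m\<in>Poly_Mapping.keys p. Poly_Mapping.keys m \<subseteq> X \<and> (\<forall>x. Poly_Mapping.lookup m x < 0 \<longrightarrow> x \<in> U)},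
      mult = (*), one = 1, zero = 0, add = (+)\<rparr>"

text \<open>A presentation of an affine \<open>k\<close>-scheme: the variables, those among them that are
  required to be invertible, and the functions that are required to vanish.\<close>

record ('x, 'p) presentation =
  variables :: "'x set"
  invertibles :: "'x set"
  equations :: "'p set"

type_synonym ('x, 'k) affine_scheme = "('x, ('x, 'k) laurent) presentation"

definition ambient_ring :: "('x, 'k::field) affine_scheme \<Rightarrow> ('x, 'k) laurent ring" where
  "ambient_ring Y = laurent_ring (variables Y) (invertibles Y)"

definition defining_ideal :: "('x, 'k::field) affine_scheme \<Rightarrow> ('x, 'k) laurent set" where
  "defining_ideal Y = genideal (ambient_ring Y) (equations Y)"

definition coordinate_ring :: "('x, 'k::field) affine_scheme \<Rightarrow> ('x, 'k) laurent set ring" where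
  "coordinate_ring Y = ambient_ring Y Quot defining_ideal Y"

definition structure_map :: "('x, 'k::field) affine_scheme \<Rightarrow> 'k \<Rightarrow> ('x, 'k) laurent set" where
  "structure_map Y c = defining_ideal Y +>\<^bsub>ambient_ring Y\<^esub> const c"

text \<open>Isomorphisms of affine schemes over \<open>k\<close> are isomorphisms of their coordinate rings
  as \<open>k\<close>-algebras.\<close>

definition scheme_isomorphic ::
    "('x, 'k::field) affine_scheme \<Rightarrow> ('y, 'k) affine_scheme \<Rightarrow> bool" where
  "scheme_isomorphic Y Z \<longleftrightarrow>
     (\<exists>h \<in> ring_iso (coordinate_ring Y) (coordinate_ring Z).
        \<forall>c. h (structure_map Y c) = structure_map Z c)"

text \<open>The locally closed subscheme of \<open>Y\<close> on which the variables in \<open>A\<close> vanish and those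
  in \<open>B\<close> are nonzero, i.e. the closed subscheme \<open>V(A)\<close> of the basic open subset \<open>D(\<Prod>B)\<close>.\<close>

definition stratum ::
    "('x, 'k::field) affine_scheme \<Rightarrow> 'x set \<Rightarrow> 'x set \<Rightarrow> ('x, 'k) affine_scheme" where
  "stratum Y A B =
     \<lparr>variables = variables Y,
      invertibles = invertibles Y \<union> B,
      equations = equations Y \<union> var ` A\<rparr>"

text \<open>\<open>(\<bbbG>\<^sub>m)\<^sup>n \<times> (\<bbbA>\<^sup>1)\<^sup>s\<close>: the coordinates \<open>Inl i\<close> belong to the torus, the coordinates
  \<open>Inr j\<close> to the affine space.\<close>

definition torus_times_affine :: "nat \<Rightarrow> nat \<Rightarrow> (nat + nat, 'k::field) affine_scheme" where
  "torus_times_affine n s =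
     \<lparr>variables = Inl ` {..<n} \<union> Inr ` {..<s},
      invertibles = Inl ` {..<n},
      equations = {}\<rparr>"


section \<open>The versal scheme of a tree and its strata\<close>

datatype 'v tree_var = VarX 'v | VarX' 'v | VarAlpha 'v

definition alpha :: "'v set set \<Rightarrow> 'v \<Rightarrow> ('v tree_var, 'k::field) laurent" where
  "alpha M i = (if i \<in> \<Union>M then 1 else var (VarAlpha i))"

definition X_versal ::
    "'v set \<Rightarrow> 'v set set \<Rightarrow> 'v set set \<Rightarrow> ('v tree_var, 'k::field) affine_scheme" where
  "X_versal V E M =
     \<lparr>variables = VarX ` V \<union> VarX' ` V \<union> VarAlpha ` (V - \<Union>M),
      invertibles = VarAlpha ` (V - \<Union>M),
      equations =
        {var (VarX i) * var (VarX' i)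
           - (1 + alpha M i * (\<Prod>j\<in>neighbors V E i. var (VarX j))) | i. i \<in> V}\<rparr>"

definition W_stratum ::
    "'v set \<Rightarrow> 'v set set \<Rightarrow> 'v set set \<Rightarrow> 'v set \<Rightarrow> ('v tree_var, 'k::field) affine_scheme"
  where
  "W_stratum V E M S = stratum (X_versal V E M) (VarX ` S) (VarX ` (V - S))"

end

theory Submission
  imports Defs
begin

text \<open>On the stratum, the equation of a vertex \<open>i \<notin> S\<close> merely determines \<open>x'\<^sub>i\<close>, since \<open>x\<^sub>i\<close> is
  invertible.  For \<open>i \<in> S\<close> the variable \<open>x'\<^sub>i\<close> is free, which gives the affine factor, and the
  equation becomes the condition that the monomial \<open>\<alpha>\<^sub>i \<Prod>\<^sub>j x\<^sub>j\<close> of invertible variables equals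
  \<open>-1\<close>.  This monomial contains to the first power a pivot, namely the variable of the
  \<open>M\<close>-partner of \<open>i\<close>, or \<open>\<alpha>\<^sub>i\<close> if \<open>i\<close> is not covered.  Since \<open>T\<close> has no cycle, the matrix of
  pivots is triangular: otherwise alternating between \<open>S\<close> and \<open>M\<close>-partners would give an
  infinite walk without backtracking.  So the pivots can be eliminated, and the remaining
  \<open>t + |V - \<Union>M| - 2 s\<close> invertible variables are coordinates of the torus.  By Koenig's theorem
  every minimum vertex cover meets each edge of \<open>M\<close> exactly once and avoids the uncovered
  vertices; hence \<open>M\<close> pairs each green vertex with a red one, and the other red vertices are
  exactly the uncovered ones.\<close>

section \<open>Acyclic graphs and their matchings\<close>

lemma graph_cycle_mono: "E \<subseteq> E' \<Longrightarrow> graph_cycle E p \<Longrightarrow> graph_cycle E' p"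
  unfolding graph_cycle_def by blast

lemma graph_edge:
  assumes "simple_graph V E" "{a, b} \<in> E"
  shows "a \<in> V" "b \<in> V" "a \<noteq> b"
proof -
  have "{a, b} \<subseteq> V" "card {a, b} = 2" using assms unfolding simple_graph_def by blast+
  then show "a \<in> V" "b \<in> V" "a \<noteq> b" by (auto simp: card_insert_if)
qed

text \<open>Finiteness of \<open>V\<close> forces a repetition. One at the least distance
  \<open>d\<close> has no repetition inside it; \<open>d\<close> is not 1 as edges join distinct
  vertices, and not 2 as the walk never turns back.\<close>

lemma nonbacktracking_walk_has_cycle:
  fixes w :: "nat \<Rightarrow> 'v"
  assumes graph: "simple_graph V E"
    and edge: "\<And>n. {w n, w (Suc n)} \<in> E"
    and turn: "\<And>n. w (Suc (Suc n)) \<noteq> w n"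
  shows "\<exists>p. graph_cycle E p"
proof -
  have "range w \<subseteq> V"
    using edge graph unfolding simple_graph_def by blast
  then have "\<not> inj w"
    using graph finite_subset[of "range w" V] finite_imageD[of w UNIV]
    unfolding simple_graph_def by auto
  then obtain a b where "a < b" "w a = w b" by (metis linorder_injI)
  then have "\<exists>d i. 0 < d \<and> w i = w (i + d)"
    by (intro exI[of _ "b - a"] exI[of _ a]) simp
  define d where "d = (LEAST d. \<exists>i. 0 < d \<and> w i = w (i + d))"
  obtain i where d: "0 < d" "w i = w (i + d)"
    using LeastI_ex[OF \<open>\<exists>d i. _ d i\<close>] unfolding d_def by blast
  have least: "w a \<noteq> w (a + c)" if "0 < c" "c < d" for a c
    using that not_less_Least unfolding d_def by blast
  have "w n \<noteq> w (Suc n)" for n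
    by (rule graph_edge(3)[OF graph edge])
  then have "d \<noteq> 1" using d(2) by (metis Suc_eq_plus1)
  moreover have "d \<noteq> 2" using d(2) turn[of i] by (metis add_2_eq_Suc')
  ultimately have "3 \<le> d" using d(1) by linarith
  define p where "p = map w [i..<i + d]"
  have len: "length p = d" and nth: "p ! k = w (i + k)" if "k < d" for k
    using that d(1) unfolding p_def by auto
  then have length: "length p = d" using d(1) by blast
  have "inj_on w {i..<i + d}"
  proof (rule linorder_inj_onI)
    fix a b assume "a < b" "a \<in> {i..<i + d}" "b \<in> {i..<i + d}"
    then show "w a \<noteq> w b" using least[of "b - a" a] by auto
  qed auto
  then have "distinct p" unfolding p_def by (simp add: distinct_map)
  moreover have "{p ! k, p ! (Suc k mod d)} \<in> E" if "k < d" for k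
  proof (cases "Suc k = d")
    \<comment> \<open>Here the index wraps around to 0; the closing edge leads to
      \<open>w (i + d)\<close>, which is \<open>w i\<close>.\<close>
    case True
    then have "p ! (Suc k mod d) = w (Suc (i + k))" using nth[of 0] d by auto
    then show ?thesis using nth[OF that] edge[of "i + k"] by simp
  next
    case False
    then show ?thesis using nth[OF that] nth[of "Suc k"] edge[of "i + k"] that by simp
  qed
  ultimately have "graph_cycle E p"
    unfolding graph_cycle_def using length \<open>3 \<le> d\<close> by simp
  then show ?thesis ..
qed

text \<open>Without a leaf, every step along an edge can be continued by an edge to a different
  vertex, which gives an infinite walk without turning back.\<close>

lemma acyclic_graph_has_leaf:
  assumes graph: "simple_graph V E" and acyclic: "\<nexists>p. graph_cycle E p" and "E \<noteq> {}"
  obtains (leaf) l p where "{l, p} \<in> E" "\<And>q. {l, q} \<in> E \<Longrightarrow> q = p"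
proof (rule ccontr)
  assume no_leaf: "\<not> thesis"
  have branch: "\<exists>q. {b, q} \<in> E \<and> q \<noteq> a" if "{a, b} \<in> E" for a b
  proof (rule ccontr)
    assume "\<nexists>q. {b, q} \<in> E \<and> q \<noteq> a"
    moreover have "{b, a} \<in> E" using that by (simp add: insert_commute)
    ultimately show False using leaf no_leaf by blast
  qed
  obtain e where "e \<in> E" using \<open>E \<noteq> {}\<close> by blast
  then obtain a0 b0 where start: "{a0, b0} \<in> E"
    using graph card_2_iff[of e] unfolding simple_graph_def by blast
  \<comment> \<open>The walk is built as a sequence of directed edges, so that each choice knows the
    vertex to be avoided.\<close>
  have "\<exists>f. \<forall>n. {fst (f n), snd (f n)} \<in> E \<and>
          (fst (f (Suc n)) = snd (f n) \<and> snd (f (Suc n)) \<noteq> fst (f n))"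
  proof (rule dependent_nat_choice)
    show "\<exists>x. {fst x, snd x} \<in> E" using start by auto
  next
    fix x :: "'a \<times> 'a" and n :: nat
    assume "{fst x, snd x} \<in> E"
    then obtain q where "{snd x, q} \<in> E" "q \<noteq> fst x" using branch by blast
    then show "\<exists>y. {fst y, snd y} \<in> E \<and> fst y = snd x \<and> snd y \<noteq> fst x"
      by (intro exI[of _ "(snd x, q)"]) auto
  qed
  then obtain f where f: "\<And>n. {fst (f n), snd (f n)} \<in> E"
      "\<And>n. fst (f (Suc n)) = snd (f n)" "\<And>n. snd (f (Suc n)) \<noteq> fst (f n)"
    by blast
  have "\<exists>p. graph_cycle E p"
  proof (rule nonbacktracking_walk_has_cycle[OF graph])
    show "{fst (f n), fst (f (Suc n))} \<in> E" for n using f(1)[of n] f(2) by simp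
    show "fst (f (Suc (Suc n))) \<noteq> fst (f n)" for n using f(2,3) by simp
  qed
  then show False using acyclic by blast
qed

section \<open>Koenig's theorem and the canonical coloring\<close>

lemma acyclic_graph_koenig:
  assumes "simple_graph V E" and "\<nexists>p. graph_cycle E p"
  obtains N C where "matching V E N" "vertex_cover V E C" "card C \<le> card N"
proof -
  have "finite E"
    using assms(1) finite_subset[of E "Pow V"] unfolding simple_graph_def by auto
  then have "\<exists>N C. matching V E N \<and> vertex_cover V E C \<and> card C \<le> card N"
    using assms
  proof (induction E rule: finite_psubset_induct)
    case (psubset E)
    show ?case
    proof (cases "E = {}")
      case True
      then show ?thesis
        by (intro exI[of _ "{}"]) (auto simp: matching_def vertex_cover_def)
    next
      case False
      obtain l p where leaf: "{l, p} \<in> E" "\<And>q. {l, q} \<in> E \<Longrightarrow> q = p"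
        using acyclic_graph_has_leaf[OF psubset.prems False] by blast
      \<comment> \<open>Deleting all edges at the neighbour \<open>p\<close> of the leaf isolates
        \<open>l\<close>. The edge \<open>{l, p}\<close> then enlarges the matching and
        \<open>p\<close> enlarges the cover, each by one; \<open>V\<close> stays fixed.\<close>
      define E' where "E' = {e \<in> E. p \<notin> e}"
      have "E' \<subseteq> E" "{l, p} \<notin> E'" unfolding E'_def by auto
      then have sub: "E' \<subset> E" using leaf(1) by (auto simp: psubset_eq)
      have E': "simple_graph V E'" "\<nexists>q. graph_cycle E' q"
        using psubset.prems sub graph_cycle_mono[of E' E] unfolding simple_graph_def by blast+
      obtain N C where NC: "matching V E' N" "vertex_cover V E' C" "card C \<le> card N"
        using psubset.IH[OF sub E'] by blast
      have "p \<in> V" by (rule graph_edge(2)[OF psubset.prems(1) leaf(1)])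
      have N: "p \<notin> e" "e \<in> E" if "e \<in> N" for e
        using NC(1) that unfolding matching_def E'_def by auto
      have "l \<notin> e" if "e \<in> N" for e
      proof
        have "e \<in> E" by (rule N(2)[OF that])
        assume "l \<in> e"
        moreover have "card e = 2"
          using \<open>e \<in> E\<close> psubset.prems(1) unfolding simple_graph_def by auto
        ultimately obtain q where "e = {l, q}" unfolding card_2_iff by (elim exE conjE) blast
        then show False
          using leaf(2) N[OF that] by blast
      qed
      with N(1) have "v \<notin> e" if "e \<in> N" "v \<in> {l, p}" for e v using that by auto
      then have "matching V E (insert {l, p} N)"
        using NC(1) N(2) leaf(1) unfolding matching_def by (auto simp: subset_iff)
      moreover have "vertex_cover V E (insert p C)"
        using NC(2) \<open>p \<in> V\<close> unfolding vertex_cover_def E'_def by blast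
      moreover have "card (insert {l, p} N) = Suc (card N)"
      proof (rule card_insert_disjoint)
        show "finite N"
          using N(2) psubset.hyps(1) finite_subset[of N E] by auto
        show "{l, p} \<notin> N" using N(1) by blast
      qed
      moreover have "card (insert p C) \<le> Suc (card C)" by (cases "finite C") (simp_all add: card_insert_if)
      ultimately show ?thesis using NC(3)
        by (intro exI[of _ "insert {l, p} N"] exI[of _ "insert p C"]) simp
    qed
  qed
  then show thesis using that by blast
qed

text \<open>\<open>C\<close> meets the disjoint edges of \<open>M\<close>, and Koenig gives
  \<open>card C \<le> card M\<close>. So the map from covered vertices of \<open>C\<close> to their
  edges of \<open>M\<close> is a bijection and leaves no vertex of \<open>C\<close> over.\<close>

lemma max_matching_transversal:
  assumes graph: "simple_graph V E" and "\<nexists>p. graph_cycle E p"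
    and M: "max_matching V E M" and C: "min_vertex_cover V E C"
  shows "C \<subseteq> \<Union>M" and "{u, v} \<in> M \<Longrightarrow> u \<in> C \<longleftrightarrow> v \<notin> C"
proof -
  have fin: "finite V" and ME: "M \<subseteq> E"
    using graph M unfolding simple_graph_def max_matching_def matching_def by auto
  have CV: "C \<subseteq> V" and meet: "\<And>e. e \<in> M \<Longrightarrow> C \<inter> e \<noteq> {}"
    using C ME unfolding min_vertex_cover_def vertex_cover_def by blast+
  then have finC: "finite C" using fin finite_subset by blast
  have disjoint: "e = f" if "v \<in> C" "e \<in> M" "f \<in> M" "v \<in> e" "v \<in> f" for v e f
    using M CV that unfolding max_matching_def matching_def by blast
  define edge where "edge v = (THE e. e \<in> M \<and> v \<in> e)" for v
  have edge: "edge v = e" if "v \<in> C" "e \<in> M" "v \<in> e" for v e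
    unfolding edge_def by (rule the_equality) (use disjoint[OF that(1)] that in blast)+
  have "edge ` (C \<inter> \<Union>M) = M"
  proof (intro equalityI subsetI)
    fix e assume "e \<in> edge ` (C \<inter> \<Union>M)"
    then show "e \<in> M" using edge by force
  next
    fix e assume e: "e \<in> M"
    then obtain v where "v \<in> C" "v \<in> e" using meet by blast
    then show "e \<in> edge ` (C \<inter> \<Union>M)" using edge[of v e] e by (intro image_eqI[of _ _ v]) auto
  qed
  moreover have "card C \<le> card M"
  proof -
    obtain N D where "matching V E N" "vertex_cover V E D" "card D \<le> card N"
      using acyclic_graph_koenig[OF assms(1,2)] by blast
    then have "card N \<le> card M" "card C \<le> card D"
      using M C unfolding max_matching_def min_vertex_cover_def by blast+
    then show ?thesis using \<open>card D \<le> card N\<close> by linarith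
  qed
  moreover have "card (C \<inter> \<Union>M) \<le> card C"
    using finC by (intro card_mono) auto
  moreover have "card (edge ` (C \<inter> \<Union>M)) \<le> card (C \<inter> \<Union>M)"
    using finC by (intro card_image_le) auto
  ultimately have "card (C \<inter> \<Union>M) = card C"
      and card_edge: "card (edge ` (C \<inter> \<Union>M)) = card (C \<inter> \<Union>M)"
    by simp_all
  then show cov: "C \<subseteq> \<Union>M"
    using card_subset_eq[OF finC, of "C \<inter> \<Union>M"] by blast
  have inj: "inj_on edge (C \<inter> \<Union>M)"
    using finC card_edge by (intro eq_card_imp_inj_on) auto
  assume uv: "{u, v} \<in> M"
  then have "u \<noteq> v" using graph_edge(3)[OF graph] ME by blast
  show "u \<in> C \<longleftrightarrow> v \<notin> C"
  proof
    assume "u \<in> C"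
    show "v \<notin> C"
    proof
      assume "v \<in> C"
      then have "edge u = edge v"
        using edge[OF \<open>u \<in> C\<close> uv] edge[OF _ uv] by simp
      then show False
        using inj \<open>u \<noteq> v\<close> \<open>u \<in> C\<close> \<open>v \<in> C\<close> uv unfolding inj_on_def by blast
    qed
  next
    assume "v \<notin> C"
    then show "u \<in> C" using meet[OF uv] by auto
  qed
qed

lemma matching_partner:
  assumes "simple_graph V E" "matching V E M"
  obtains m where "\<And>v. v \<in> \<Union>M \<Longrightarrow> {v, m v} \<in> M" "\<And>v. v \<in> \<Union>M \<Longrightarrow> m (m v) = v"
proof -
  have ME: "M \<subseteq> E" using assms(2) unfolding matching_def by blast
  have "\<exists>u. {v, u} \<in> M" if v: "v \<in> \<Union>M" for v
  proof -
    obtain e where e: "e \<in> M" "v \<in> e" using v by blast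
    then have "card e = 2" using ME assms(1) unfolding simple_graph_def by blast
    then obtain a b where "e = {a, b}" unfolding card_2_iff by blast
    then have "e = {v, a} \<or> e = {v, b}" using e(2) by auto
    then show ?thesis using e(1) by blast
  qed
  then obtain m where m: "\<And>v. v \<in> \<Union>M \<Longrightarrow> {v, m v} \<in> M" by metis
  have "m (m v) = v" if v: "v \<in> \<Union>M" for v
  proof -
    have "m v \<in> \<Union>M" using m[OF v] by blast
    then have "{m v, m (m v)} \<in> M" by (rule m)
    moreover have "m v \<in> V" using graph_edge(2)[OF assms(1)] m[OF v] ME by blast
    then have "\<forall>e\<in>M. \<forall>f\<in>M. m v \<in> e \<longrightarrow> m v \<in> f \<longrightarrow> e = f"
      using assms(2) unfolding matching_def by blast
    ultimately have "{v, m v} = {m v, m (m v)}" using m[OF v] by simp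
    then show ?thesis by (auto simp: doubleton_eq_iff)
  qed
  then show thesis using that m by blast
qed

text \<open>For a covered vertex \<open>v\<close>, a minimum cover contains exactly one of
  \<open>v\<close> and \<open>m v\<close>. So \<open>m\<close> exchanges green vertices with covered
  red ones, and the difference counts only uncovered vertices.\<close>

lemma tree_dim_eq_card_uncovered:
  assumes graph: "simple_graph V E" and acyclic: "\<nexists>p. graph_cycle E p"
    and M: "max_matching V E M"
  shows "tree_dim V E = int (card (V - \<Union>M))"
proof -
  have fin: "finite V" and ME: "matching V E M" "M \<subseteq> E"
    using graph M unfolding simple_graph_def max_matching_def matching_def by auto
  obtain m where m: "\<And>v. v \<in> \<Union>M \<Longrightarrow> {v, m v} \<in> M" "\<And>v. v \<in> \<Union>M \<Longrightarrow> m (m v) = v"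
    using matching_partner[OF graph ME(1)] by blast
  have mV: "m v \<in> V" "m v \<in> \<Union>M" if "v \<in> \<Union>M" for v
    using graph_edge(2)[OF graph, of v "m v"] m(1)[OF that] ME(2) by blast+
  note transversal = max_matching_transversal[OF graph acyclic M]
  have "vertex_cover V E V"
    using graph unfolding vertex_cover_def simple_graph_def by (auto simp: Int_absorb1)
  \<comment> \<open>Some minimum cover must exist, since otherwise every vertex would be green
    vacuously.\<close>
  then obtain C0 where "min_vertex_cover V E C0"
    using ex_has_least_nat[of "vertex_cover V E" V card] unfolding min_vertex_cover_def by blast
  then have green_cov: "green V E \<subseteq> \<Union>M"
    using transversal(1) unfolding green_def by blast
  have "red V E = (V - \<Union>M) \<union> m ` green V E"
  proof (intro equalityI subsetI)
    fix v assume v: "v \<in> red V E"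
    show "v \<in> (V - \<Union>M) \<union> m ` green V E"
    proof (cases "v \<in> \<Union>M")
      case True
      then have "m v \<in> green V E"
        using v transversal(2)[OF _ m(1)] mV[OF True] unfolding red_def green_def by blast
      then show ?thesis using m(2)[OF True] by (metis UnI2 image_eqI)
    next
      case False
      then show ?thesis using v unfolding red_def by blast
    qed
  next
    fix v assume "v \<in> (V - \<Union>M) \<union> m ` green V E"
    then show "v \<in> red V E"
    proof
      assume "v \<in> V - \<Union>M"
      then show ?thesis using transversal(1) unfolding red_def by blast
    next
      assume "v \<in> m ` green V E"
      then obtain u where u: "u \<in> green V E" "v = m u" by blast
      then show ?thesis
        using transversal(2)[OF _ m(1), of _ u] mV[of u] green_cov
        unfolding red_def green_def by blast
    qed
  qed
  moreover have "(V - \<Union>M) \<inter> m ` green V E = {}" using mV green_cov by blast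
  moreover have "inj_on m (green V E)" using m(2) green_cov by (metis inj_on_inverseI subsetD)
  moreover have "finite (green V E)" using fin unfolding green_def by simp
  ultimately have "card (red V E) = card (V - \<Union>M) + card (green V E)"
    using fin by (simp add: card_Un_disjoint card_image)
  then show ?thesis unfolding tree_dim_def by simp
qed

lemma matched_independent_set_has_pivot:
  assumes graph: "simple_graph V E" and acyclic: "\<nexists>p. graph_cycle E p"
    and M: "matching V E M" and S: "independent_set V E S" "S \<subseteq> \<Union>M" "S \<noteq> {}"
    and m: "\<And>v. v \<in> \<Union>M \<Longrightarrow> {v, m v} \<in> M" "\<And>v. v \<in> \<Union>M \<Longrightarrow> m (m v) = v"
  obtains i where "i \<in> S" "\<And>j. j \<in> S \<Longrightarrow> {j, m i} \<in> E \<Longrightarrow> j = i"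
proof (rule ccontr)
  assume "\<not> thesis"
  then have "\<forall>i\<in>S. \<exists>j. j \<in> S \<and> {j, m i} \<in> E \<and> j \<noteq> i" using that by blast
  then obtain g where g: "\<And>i. i \<in> S \<Longrightarrow> g i \<in> S \<and> {g i, m i} \<in> E \<and> g i \<noteq> i" by metis
  obtain i0 where "i0 \<in> S" using S(3) by blast
  then have orbit: "(g ^^ n) i0 \<in> S" for n by (induction n) (use g in auto)
  \<comment> \<open>The walk is \<open>i\<close>, \<open>m i\<close>, \<open>g i\<close>,
    \<open>m (g i)\<close>, and so on. It cannot turn back at a partner since
    \<open>g i \<noteq> i\<close>, nor at a vertex of \<open>S\<close> since \<open>m\<close> is
    injective on \<open>S\<close>.\<close>
  define w where "w n = (if even n then (g ^^ (n div 2)) i0 else m ((g ^^ (n div 2)) i0))" for n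
  have edge: "{i, m i} \<in> E" if "i \<in> S" for i
    using m(1)[OF subsetD[OF S(2) that]] M unfolding matching_def by blast
  have "\<exists>p. graph_cycle E p"
  proof (rule nonbacktracking_walk_has_cycle[OF graph])
    fix n
    show "{w n, w (Suc n)} \<in> E"
      unfolding w_def using g edge orbit[of "n div 2"]
      by (cases "even n") (simp_all add: insert_commute)
    have "m (g i) \<noteq> m i" if "i \<in> S" for i
    proof
      assume "m (g i) = m i"
      then have "g i = i" using m(2) that g S(2) by (metis subsetD)
      then show False using g that by blast
    qed
    then show "w (Suc (Suc n)) \<noteq> w n"
      unfolding w_def using g orbit[of "n div 2"] by auto
  qed
  then show False using acyclic by blast
qed

section \<open>Evaluation of Laurent polynomials\<close>

text \<open>\<open>b\<close> plays the role of the inverse of \<open>a\<close>, and is irrelevant if \<open>k \<ge> 0\<close>.\<close>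

definition zpow :: "'a::comm_monoid_mult \<Rightarrow> 'a \<Rightarrow> int \<Rightarrow> 'a" where
  "zpow a b k = a ^ nat k * b ^ nat (- k)"

text \<open>Exponent pairs with the same difference differ by a power of \<open>a * b\<close>, which
  is 1.\<close>

lemma zpow_eq:
  assumes "a * b = 1" "k = int p - int q"
  shows "zpow a b k = a ^ p * b ^ q"
proof -
  have one: "a ^ n * b ^ n = 1" for n by (metis assms(1) power_mult_distrib power_one)
  have "nat k + q = nat (- k) + p" using assms(2) by linarith
  have "zpow a b k * (a ^ q * b ^ q) = a ^ (nat k + q) * b ^ (nat (- k) + q)"
    by (simp add: zpow_def power_add ac_simps)
  also have "\<dots> = a ^ p * b ^ q * (a ^ nat (- k) * b ^ nat (- k))"
    unfolding \<open>nat k + q = nat (- k) + p\<close> by (simp add: power_add ac_simps)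
  finally show ?thesis by (simp add: one)
qed

text \<open>The premise is conditional so that the law also serves variables that are not
  invertible: their exponents are nonnegative, and only powers of \<open>a\<close> occur.\<close>

lemma zpow_add:
  assumes "k < 0 \<or> l < 0 \<Longrightarrow> a * b = 1"
  shows "zpow a b (k + l) = zpow a b k * zpow a b l"
proof (cases "a * b = 1")
  case True
  have "zpow a b (k + l) = a ^ (nat k + nat l) * b ^ (nat (- k) + nat (- l))"
    by (rule zpow_eq[OF True]) linarith
  then show ?thesis by (simp add: zpow_def power_add ac_simps)
next
  case False
  then have "0 \<le> k" "0 \<le> l" using assms by force+
  then show ?thesis by (simp add: zpow_def nat_add_distrib power_add)
qed

section \<open>Admissible monomials and the ring they span\<close>

definition admissible :: "'x set \<Rightarrow> 'x set \<Rightarrow> ('x \<Rightarrow>\<^sub>0 int) \<Rightarrow> bool" where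
  "admissible X U m \<longleftrightarrow>
     Poly_Mapping.keys m \<subseteq> X \<and> (\<forall>x. Poly_Mapping.lookup m x < 0 \<longrightarrow> x \<in> U)"

lemma admissible_0: "admissible X U 0"
  by (simp add: admissible_def)

lemma admissible_add: "admissible X U m \<Longrightarrow> admissible X U n \<Longrightarrow> admissible X U (m + n)"
  unfolding admissible_def using keys_add[of m n]
  by (auto simp: lookup_add) (metis add_nonneg_nonneg not_less)

lemma laurent_carrier_iff:
  "p \<in> carrier (laurent_ring X U) \<longleftrightarrow> (\<forall>m\<in>Poly_Mapping.keys p. admissible X U m)"
  by (simp add: laurent_ring_def admissible_def)

lemma laurent_ring_simps [simp]:
  "mult (laurent_ring X U) = (*)" "one (laurent_ring X U) = 1"
  "zero (laurent_ring X U) = 0" "add (laurent_ring X U) = (+)"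
  by (simp_all add: laurent_ring_def)

definition ivar :: "'x \<Rightarrow> ('x, 'k::comm_ring_1) laurent" where
  "ivar x = Poly_Mapping.single (Poly_Mapping.single x (-1)) 1"

lemma var_mult_ivar: "var x * ivar x = 1"
  by (simp add: var_def ivar_def mult_single flip: single_add)

lemma const_0 [simp]: "const 0 = 0" and const_1 [simp]: "const 1 = 1"
  and const_add: "const (a + b) = const a + const b"
  and const_mult: "const (a * b) = const a * const b"
  by (simp_all add: const_def single_add mult_single)

lemma single_closed:
  "admissible X U m \<Longrightarrow> Poly_Mapping.single m c \<in> carrier (laurent_ring X U)"
  by (simp add: laurent_carrier_iff)

lemma const_closed: "const c \<in> carrier (laurent_ring X U)"
  unfolding const_def by (intro single_closed admissible_0)

lemma var_closed: "x \<in> X \<Longrightarrow> var x \<in> carrier (laurent_ring X U)"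
  unfolding var_def by (intro single_closed) (auto simp: admissible_def lookup_single when_def)

lemma ivar_closed: "x \<in> X \<Longrightarrow> x \<in> U \<Longrightarrow> ivar x \<in> carrier (laurent_ring X U)"
  unfolding ivar_def by (intro single_closed) (auto simp: admissible_def lookup_single when_def)

lemma laurent_0_closed: "0 \<in> carrier (laurent_ring X U)"
  by (simp add: laurent_carrier_iff)

lemma laurent_1_closed: "1 \<in> carrier (laurent_ring X U)"
  using const_closed[of 1] by simp

lemma laurent_add_closed:
  "p \<in> carrier (laurent_ring X U) \<Longrightarrow> q \<in> carrier (laurent_ring X U) \<Longrightarrow>
   p + q \<in> carrier (laurent_ring X U)"
  using keys_add[of p q] by (auto simp: laurent_carrier_iff)

lemma laurent_mult_closed:
  "p \<in> carrier (laurent_ring X U) \<Longrightarrow> q \<in> carrier (laurent_ring X U) \<Longrightarrow>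
   p * q \<in> carrier (laurent_ring X U)"
  using keys_mult[of p q] admissible_add by (fastforce simp: laurent_carrier_iff)

lemma laurent_uminus_closed:
  "p \<in> carrier (laurent_ring X U) \<Longrightarrow> - p \<in> carrier (laurent_ring X U)"
  by (simp add: laurent_carrier_iff in_keys_iff)

lemma laurent_sum_closed:
  "(\<And>i. i \<in> A \<Longrightarrow> f i \<in> carrier (laurent_ring X U)) \<Longrightarrow> sum f A \<in> carrier (laurent_ring X U)"
  by (induction A rule: infinite_finite_induct) (auto intro: laurent_0_closed laurent_add_closed)

lemma laurent_prod_closed:
  "(\<And>i. i \<in> A \<Longrightarrow> f i \<in> carrier (laurent_ring X U)) \<Longrightarrow> prod f A \<in> carrier (laurent_ring X U)"
  by (induction A rule: infinite_finite_induct) (auto intro: laurent_1_closed laurent_mult_closed)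

lemma laurent_power_closed:
  "p \<in> carrier (laurent_ring X U) \<Longrightarrow> p ^ n \<in> carrier (laurent_ring X U)"
  by (induction n) (auto intro: laurent_1_closed laurent_mult_closed)

lemmas laurent_closed = const_closed var_closed ivar_closed laurent_0_closed laurent_1_closed
  laurent_add_closed laurent_mult_closed laurent_uminus_closed laurent_sum_closed
  laurent_prod_closed laurent_power_closed

lemma cring_laurent_ring: "cring (laurent_ring X U :: ('x, 'k::comm_ring_1) laurent ring)"
proof (rule cringI)
  show "abelian_group (laurent_ring X U :: ('x, 'k) laurent ring)"
    by (rule abelian_groupI)
      (auto simp: laurent_closed add.assoc add.commute intro: bexI[OF _ laurent_uminus_closed])
  show "comm_monoid (laurent_ring X U :: ('x, 'k) laurent ring)"
    by (rule comm_monoidI) (auto simp: laurent_closed mult.assoc mult.commute)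
qed (simp add: distrib_right)

lemma sum_single_lookup:
  assumes "finite A" "Poly_Mapping.keys p \<subseteq> A"
  shows "(\<Sum>m\<in>A. Poly_Mapping.single m (Poly_Mapping.lookup p m)) = p"
proof (rule poly_mapping_eqI)
  fix n
  have "(\<Sum>m\<in>A. Poly_Mapping.lookup p m when m = n) = Poly_Mapping.lookup p n"
    using assms by (auto simp: when_def sum.delta in_keys_iff)
  then show "Poly_Mapping.lookup (\<Sum>m\<in>A. Poly_Mapping.single m (Poly_Mapping.lookup p m)) n =
      Poly_Mapping.lookup p n"
    by (simp add: lookup_sum lookup_single)
qed

lemma single_sum_one:
  "finite A \<Longrightarrow> Poly_Mapping.single (sum f A) 1 = (\<Prod>x\<in>A. Poly_Mapping.single (f x) (1::'k::comm_ring_1))"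
proof (induction A rule: finite_induct)
  case (insert x A)
  have "Poly_Mapping.single (sum f (insert x A)) 1 =
      Poly_Mapping.single (f x) (1::'k) * Poly_Mapping.single (sum f A) 1"
    using insert.hyps by (simp add: mult_single)
  then show ?case using insert by simp
qed simp

lemma single_single_power:
  "Poly_Mapping.single (Poly_Mapping.single x k) (1::'k::comm_ring_1) ^ n =
   Poly_Mapping.single (Poly_Mapping.single x (int n * k)) 1"
  by (induction n) (simp_all add: mult_single algebra_simps flip: single_add)

text \<open>The ring is generated by constants, variables and the permitted inverses: each monomial
  is a product of powers of \<open>var x\<close> or \<open>ivar x\<close>, according to the sign of
  the exponent.\<close>

lemma laurent_ring_induct [consumes 1, case_names const var ivar add mult]:
  fixes p :: "('x, 'k::comm_ring_1) laurent"
  assumes p: "p \<in> carrier (laurent_ring X U)"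
    and const: "\<And>c. P (const c)"
    and var: "\<And>x. x \<in> X \<Longrightarrow> P (var x)"
    and ivar: "\<And>x. x \<in> X \<Longrightarrow> x \<in> U \<Longrightarrow> P (ivar x)"
    and add: "\<And>p q. P p \<Longrightarrow> P q \<Longrightarrow> P (p + q)"
    and mult: "\<And>p q. P p \<Longrightarrow> P q \<Longrightarrow> P (p * q)"
  shows "P p"
proof -
  have sum: "P (sum f A)" if "\<And>i. i \<in> A \<Longrightarrow> P (f i)" for f :: "('x \<Rightarrow>\<^sub>0 int) \<Rightarrow> _" and A
    using that const[of 0] add by (induction A rule: infinite_finite_induct) auto
  have prod: "P (prod f A)" if "\<And>i. i \<in> A \<Longrightarrow> P (f i)" for f :: "'x \<Rightarrow> _" and A
    using that const[of 1] mult by (induction A rule: infinite_finite_induct) auto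
  have power: "P (q ^ n)" if "P q" for q n
    using that const[of 1] mult by (induction n) auto
  have "P (Poly_Mapping.single m c)" if m: "admissible X U m" for m c
  proof -
    have "P (Poly_Mapping.single (Poly_Mapping.single x (Poly_Mapping.lookup m x)) 1)"
      if "x \<in> Poly_Mapping.keys m" for x
    proof (cases "0 \<le> Poly_Mapping.lookup m x")
      case True
      then have "Poly_Mapping.single (Poly_Mapping.single x (Poly_Mapping.lookup m x)) 1 =
          var x ^ nat (Poly_Mapping.lookup m x)"
        unfolding var_def single_single_power by simp
      then show ?thesis using power[OF var] m that unfolding admissible_def by (metis subsetD)
    next
      case False
      then have "Poly_Mapping.single (Poly_Mapping.single x (Poly_Mapping.lookup m x)) 1 =
          ivar x ^ nat (- Poly_Mapping.lookup m x)"
        unfolding ivar_def single_single_power by simp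
      then show ?thesis using power[OF ivar] m that False unfolding admissible_def by (metis subsetD not_le)
    qed
    then have "P (Poly_Mapping.single m 1)"
      using prod single_sum_one[of "Poly_Mapping.keys m" "\<lambda>x. Poly_Mapping.single x (Poly_Mapping.lookup m x)"]
        sum_single_lookup[of "Poly_Mapping.keys m" m] by (metis (no_types, lifting) finite_keys subset_refl)
    moreover have "Poly_Mapping.single m c = const c * Poly_Mapping.single m 1"
      by (simp add: const_def mult_single)
    ultimately show ?thesis using mult const by simp
  qed
  then have "P (\<Sum>m\<in>Poly_Mapping.keys p. Poly_Mapping.single m (Poly_Mapping.lookup p m))"
    using p by (intro sum) (simp add: laurent_carrier_iff)
  then show ?thesis by (simp add: sum_single_lookup)
qed

section \<open>Evaluation homomorphisms\<close>

definition monomial_eval ::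
    "('x \<Rightarrow> 'a) \<Rightarrow> ('x \<Rightarrow> 'a) \<Rightarrow> ('x \<Rightarrow>\<^sub>0 int) \<Rightarrow> 'a::comm_monoid_mult" where
  "monomial_eval F G m = (\<Prod>x\<in>Poly_Mapping.keys m. zpow (F x) (G x) (Poly_Mapping.lookup m x))"

text \<open>\<open>F\<close> gives the values of the variables; \<open>G\<close> gives the values of their inverses and is
  only relevant on the invertible variables.\<close>

definition laurent_eval ::
    "('x \<Rightarrow> ('y, 'k) laurent) \<Rightarrow> ('x \<Rightarrow> ('y, 'k) laurent) \<Rightarrow> ('x, 'k::comm_ring_1) laurent \<Rightarrow> ('y, 'k) laurent"
  where
  "laurent_eval F G p =
     (\<Sum>m\<in>Poly_Mapping.keys p. const (Poly_Mapping.lookup p m) * monomial_eval F G m)"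

lemma monomial_eval_superset:
  assumes "finite A" "Poly_Mapping.keys m \<subseteq> A"
  shows "monomial_eval F G m = (\<Prod>x\<in>A. zpow (F x) (G x) (Poly_Mapping.lookup m x))"
  unfolding monomial_eval_def
  by (rule prod.mono_neutral_left) (use assms in \<open>auto simp: in_keys_iff zpow_def\<close>)

lemma monomial_eval_add:
  assumes "\<And>x. x \<in> U \<Longrightarrow> F x * G x = 1" "admissible X U m" "admissible X U n"
  shows "monomial_eval F G (m + n) = monomial_eval F G m * monomial_eval F G n"
proof -
  let ?A = "Poly_Mapping.keys m \<union> Poly_Mapping.keys n"
  have "monomial_eval F G l = (\<Prod>x\<in>?A. zpow (F x) (G x) (Poly_Mapping.lookup l x))"
    if "Poly_Mapping.keys l \<subseteq> ?A" for l
    using that by (intro monomial_eval_superset) auto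
  moreover have "zpow (F x) (G x) (Poly_Mapping.lookup (m + n) x) =
      zpow (F x) (G x) (Poly_Mapping.lookup m x) * zpow (F x) (G x) (Poly_Mapping.lookup n x)" for x
    unfolding lookup_add by (rule zpow_add) (use assms in \<open>auto simp: admissible_def\<close>)
  ultimately show ?thesis using keys_add[of m n] by (simp add: prod.distrib)
qed

lemma laurent_eval_superset:
  assumes "finite A" "Poly_Mapping.keys p \<subseteq> A"
  shows "laurent_eval F G p = (\<Sum>m\<in>A. const (Poly_Mapping.lookup p m) * monomial_eval F G m)"
  unfolding laurent_eval_def
  by (rule sum.mono_neutral_left) (use assms in \<open>auto simp: in_keys_iff\<close>)

lemma laurent_eval_add: "laurent_eval F G (p + q) = laurent_eval F G p + laurent_eval F G q"
proof -
  let ?A = "Poly_Mapping.keys p \<union> Poly_Mapping.keys q"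
  have "laurent_eval F G r = (\<Sum>m\<in>?A. const (Poly_Mapping.lookup r m) * monomial_eval F G m)"
    if "Poly_Mapping.keys r \<subseteq> ?A" for r
    using that by (intro laurent_eval_superset) auto
  then show ?thesis
    using keys_add[of p q] by (simp add: lookup_add const_add distrib_right sum.distrib)
qed

lemma laurent_eval_single:
  "laurent_eval F G (Poly_Mapping.single m c) = const c * monomial_eval F G m"
  by (cases "c = 0") (simp_all add: laurent_eval_def)

lemma laurent_eval_const [simp]: "laurent_eval F G (const c) = const c"
  unfolding const_def[of c] laurent_eval_single by (simp add: monomial_eval_def const_def)

lemma laurent_eval_0 [simp]: "laurent_eval F G 0 = 0"
  by (simp add: laurent_eval_def)

lemma laurent_eval_1 [simp]: "laurent_eval F G 1 = 1"
  using laurent_eval_const[of F G 1] by simp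

lemma laurent_eval_var [simp]: "laurent_eval F G (var x) = F x"
  unfolding var_def laurent_eval_single by (simp add: monomial_eval_def zpow_def)

lemma laurent_eval_ivar [simp]: "laurent_eval F G (ivar x) = G x"
  unfolding ivar_def laurent_eval_single by (simp add: monomial_eval_def zpow_def)

lemma laurent_eval_sum: "laurent_eval F G (sum f A) = (\<Sum>i\<in>A. laurent_eval F G (f i))"
  by (induction A rule: infinite_finite_induct) (simp_all add: laurent_eval_add)

text \<open>Outside the carrier this can fail: \<open>var x * ivar x\<close> is 1, while
  \<open>F x * G x\<close> may be anything. Inside, bilinearity reduces it to admissible
  monomials.\<close>

lemma laurent_eval_mult:
  fixes p q :: "('x, 'k::comm_ring_1) laurent"
  assumes units: "\<And>x. x \<in> U \<Longrightarrow> F x * G x = 1"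
    and "p \<in> carrier (laurent_ring X U)" "q \<in> carrier (laurent_ring X U)"
  shows "laurent_eval F G (p * q) = laurent_eval F G p * laurent_eval F G q"
proof -
  let ?s = "\<lambda>p m. Poly_Mapping.single m (Poly_Mapping.lookup p m)"
  have "p * q = (\<Sum>m\<in>Poly_Mapping.keys p. ?s p m) * (\<Sum>n\<in>Poly_Mapping.keys q. ?s q n)"
    by (simp add: sum_single_lookup)
  also have "\<dots> = (\<Sum>m\<in>Poly_Mapping.keys p. \<Sum>n\<in>Poly_Mapping.keys q. ?s p m * ?s q n)"
    by (rule sum_product)
  also have "laurent_eval F G \<dots> =
      (\<Sum>m\<in>Poly_Mapping.keys p. \<Sum>n\<in>Poly_Mapping.keys q.
         laurent_eval F G (?s p m) * laurent_eval F G (?s q n))"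
    unfolding laurent_eval_sum
  proof (intro sum.cong refl)
    fix m n assume "m \<in> Poly_Mapping.keys p" "n \<in> Poly_Mapping.keys q"
    then show "laurent_eval F G (?s p m * ?s q n) = laurent_eval F G (?s p m) * laurent_eval F G (?s q n)"
      using assms monomial_eval_add[where X = X and m = m and n = n, OF units]
      by (simp add: mult_single laurent_eval_single laurent_carrier_iff const_mult mult_ac)
  qed
  also have "\<dots> = (\<Sum>m\<in>Poly_Mapping.keys p. laurent_eval F G (?s p m)) *
      (\<Sum>n\<in>Poly_Mapping.keys q. laurent_eval F G (?s q n))"
    by (rule sum_product[symmetric])
  also have "\<dots> = laurent_eval F G p * laurent_eval F G q"
    by (simp add: sum_single_lookup flip: laurent_eval_sum)
  finally show ?thesis .
qed

text \<open>The universal property of a localized polynomial ring, in the direction of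
  existence.\<close>

lemma laurent_eval_hom:
  assumes units: "\<And>x. x \<in> U \<Longrightarrow> F x * G x = 1"
    and F: "\<And>x. x \<in> X \<Longrightarrow> F x \<in> carrier (laurent_ring Y W)"
    and G: "\<And>x. x \<in> X \<Longrightarrow> x \<in> U \<Longrightarrow> G x \<in> carrier (laurent_ring Y W)"
  shows "laurent_eval F G \<in> ring_hom (laurent_ring X U) (laurent_ring Y W)"
proof (rule ring_hom_memI)
  \<comment> \<open>Membership of \<open>p\<close> is carried through the induction because
    multiplicativity is available only on the carrier.\<close>
  have closed: "p \<in> carrier (laurent_ring X U) \<and> laurent_eval F G p \<in> carrier (laurent_ring Y W)"
    if "p \<in> carrier (laurent_ring X U)" for p
    using that
    by (induction p rule: laurent_ring_induct)
      (auto simp: laurent_eval_add laurent_eval_mult[OF units] F G intro: laurent_closed)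
  then show "laurent_eval F G p \<in> carrier (laurent_ring Y W)"
    if "p \<in> carrier (laurent_ring X U)" for p using that by blast
qed (simp_all add: laurent_eval_add laurent_eval_mult[OF units])

lemma laurent_eval_prod:
  assumes "\<And>x. x \<in> U \<Longrightarrow> F x * G x = 1" "\<And>i. i \<in> A \<Longrightarrow> f i \<in> carrier (laurent_ring X U)"
  shows "laurent_eval F G (prod f A) = (\<Prod>i\<in>A. laurent_eval F G (f i))"
  using assms(2)
  by (induction A rule: infinite_finite_induct)
    (simp_all add: laurent_eval_mult[where X = X, OF assms(1)] laurent_prod_closed)

section \<open>Triangular systems of monomial equations\<close>

text \<open>Each nonempty subsystem has an equation whose pivot occurs in no other equation of that
  subsystem.  This is triangularity, stated without choosing an order on \<open>S\<close>.\<close>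

definition triangular :: "'i set \<Rightarrow> ('i \<Rightarrow> 'x set) \<Rightarrow> ('i \<Rightarrow> 'x) \<Rightarrow> bool" where
  "triangular S A piv \<longleftrightarrow>
     finite S \<and> (\<forall>i\<in>S. finite (A i) \<and> piv i \<in> A i) \<and>
     (\<forall>S'\<subseteq>S. S' \<noteq> {} \<longrightarrow> (\<exists>i\<in>S'. \<forall>j\<in>S'. piv i \<in> A j \<longrightarrow> j = i))"

text \<open>Supplies the induction step for elimination: equation \<open>i\<close> can be solved
  last, as its pivot does not occur in the remaining triangular system.\<close>

lemma triangular_obtain:
  assumes "triangular S A piv" "S \<noteq> {}"
  obtains i where "i \<in> S" "triangular (S - {i}) A piv" "\<And>j. j \<in> S - {i} \<Longrightarrow> piv i \<notin> A j"
proof -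
  have "\<exists>i\<in>S. \<forall>j\<in>S. piv i \<in> A j \<longrightarrow> j = i"
    using assms unfolding triangular_def by blast
  then obtain i where "i \<in> S" "\<forall>j\<in>S. piv i \<in> A j \<longrightarrow> j = i" by blast
  moreover have "triangular (S - {i}) A piv"
    using assms(1) unfolding triangular_def by (meson DiffE finite_Diff Diff_subset subset_trans)
  ultimately show thesis using that by blast
qed

text \<open>In the subsystem \<open>{i, j}\<close>, a common pivot would occur in both
  equations.\<close>

lemma triangular_inj: "triangular S A piv \<Longrightarrow> inj_on piv S"
proof (rule inj_onI)
  fix i j assume *: "triangular S A piv" "i \<in> S" "j \<in> S" "piv i = piv j"
  then have "\<exists>a\<in>{i, j}. \<forall>b\<in>{i, j}. piv a \<in> A b \<longrightarrow> b = a"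
    unfolding triangular_def by blast
  then show "i = j" using * unfolding triangular_def by auto
qed

text \<open>\<open>G\<close> is a group of units, and \<open>f0\<close> prescribes the free values.
  The smaller system is solved first; adjusting the pivot of the last equation then leaves it
  intact.\<close>

lemma triangular_solvable:
  fixes f0 :: "'x \<Rightarrow> 'a::comm_monoid_mult"
  assumes "triangular S A piv"
    and one: "1 \<in> G" and mult: "\<And>a b. a \<in> G \<Longrightarrow> b \<in> G \<Longrightarrow> a * b \<in> G"
    and inv: "\<And>a. a \<in> G \<Longrightarrow> \<exists>b\<in>G. a * b = 1"
    and f0: "\<And>x. f0 x \<in> G" and c: "c \<in> G"
  obtains f where "\<And>x. f x \<in> G" "\<And>x. x \<notin> piv ` S \<Longrightarrow> f x = f0 x"
    "\<And>i. i \<in> S \<Longrightarrow> (\<Prod>x\<in>A i. f x) = c"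
proof -
  have prod: "prod f B \<in> G" if "\<And>x. f x \<in> G" for f :: "'x \<Rightarrow> 'a" and B
    by (induction B rule: infinite_finite_induct) (auto simp: one mult that)
  have "finite S" using assms(1) unfolding triangular_def by blast
  then have "\<exists>f. (\<forall>x. f x \<in> G) \<and> (\<forall>x. x \<notin> piv ` S \<longrightarrow> f x = f0 x) \<and>
      (\<forall>i\<in>S. (\<Prod>x\<in>A i. f x) = c)"
    using assms(1)
  proof (induction S rule: finite_psubset_induct)
    case (psubset S)
    show ?case
    proof (cases "S = {}")
      case True
      then show ?thesis using f0 by auto
    next
      case False
      obtain i where i: "i \<in> S" "triangular (S - {i}) A piv"
          "\<And>j. j \<in> S - {i} \<Longrightarrow> piv i \<notin> A j"
        using triangular_obtain[OF psubset.prems False] by blast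
      have "S - {i} \<subset> S" using i(1) by blast
      then obtain f where f: "\<And>x. f x \<in> G" "\<And>x. x \<notin> piv ` (S - {i}) \<Longrightarrow> f x = f0 x"
          "\<And>j. j \<in> S - {i} \<Longrightarrow> (\<Prod>x\<in>A j. f x) = c"
        using psubset.IH[OF _ i(2)] by blast
      obtain b where b: "b \<in> G" "(\<Prod>x\<in>A i - {piv i}. f x) * b = 1"
        using inv[OF prod[of f, OF f(1)]] by blast
      \<comment> \<open>The value at the pivot is \<open>c\<close> divided by the product of the
        other factors.\<close>
      define f' where "f' = f(piv i := c * b)"
      have "f' x \<in> G" for x using f(1) mult[OF c b(1)] by (simp add: f'_def)
      moreover have "f' x = f0 x" if "x \<notin> piv ` S" for x
      proof -
        have "x \<noteq> piv i" "x \<notin> piv ` (S - {i})" using that i(1) by auto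
        then show ?thesis using f(2) by (simp add: f'_def)
      qed
      moreover have "(\<Prod>x\<in>A j. f' x) = c" if j: "j \<in> S" for j
      proof (cases "j = i")
        case True
        have "finite (A i)" "piv i \<in> A i"
          using psubset.prems i(1) unfolding triangular_def by auto
        then have "(\<Prod>x\<in>A i. f' x) = f' (piv i) * (\<Prod>x\<in>A i - {piv i}. f' x)"
          by (rule prod.remove)
        also have "(\<Prod>x\<in>A i - {piv i}. f' x) = (\<Prod>x\<in>A i - {piv i}. f x)"
          by (intro prod.cong) (auto simp: f'_def)
        finally show ?thesis
          using True b(2) by (simp add: f'_def mult.assoc mult.commute[of b])
      next
        case False
        then have "(\<Prod>x\<in>A j. f' x) = (\<Prod>x\<in>A j. f x)"
          using i(3)[of j] j by (intro prod.cong) (auto simp: f'_def)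
        then show ?thesis using f(3) j False by simp
      qed
      ultimately show ?thesis by blast
    qed
  qed
  then show thesis using that by blast
qed

text \<open>Allows calculation modulo the defining ideal with representatives instead of cosets.
  \<open>C\<close> is the carrier of the ring, a subset of the type.\<close>

locale ideal_congruence =
  fixes C I :: "'a::comm_ring_1 set"
  assumes one: "1 \<in> C" and mult: "a \<in> C \<Longrightarrow> b \<in> C \<Longrightarrow> a * b \<in> C"
    and ideal_0: "0 \<in> I" and ideal_add: "a \<in> I \<Longrightarrow> b \<in> I \<Longrightarrow> a + b \<in> I"
    and ideal_uminus: "a \<in> I \<Longrightarrow> - a \<in> I"
    and ideal_mult: "a \<in> I \<Longrightarrow> r \<in> C \<Longrightarrow> r * a \<in> I"
begin

definition eqv :: "'a \<Rightarrow> 'a \<Rightarrow> bool" (infix "\<approx>" 50) where "a \<approx> b \<longleftrightarrow> a - b \<in> I"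

lemma eqv_refl: "a \<approx> a"
  by (simp add: eqv_def ideal_0)

lemma eqv_sym: "a \<approx> b \<Longrightarrow> b \<approx> a"
  using ideal_uminus[of "a - b"] by (simp add: eqv_def)

lemma eqv_trans [trans]: "a \<approx> b \<Longrightarrow> b \<approx> c \<Longrightarrow> a \<approx> c"
  using ideal_add[of "a - b" "b - c"] by (simp add: eqv_def)

lemma eqv_add: "a \<approx> b \<Longrightarrow> c \<approx> d \<Longrightarrow> a + c \<approx> b + d"
  using ideal_add[of "a - b" "c - d"] by (simp add: eqv_def algebra_simps)

text \<open>From \<open>a * c - b * d = c * (a - b) + b * (c - d)\<close>; the multipliers
  \<open>c\<close> and \<open>b\<close> have to lie in \<open>C\<close>.\<close>

lemma eqv_mult:
  assumes "a \<approx> b" "c \<approx> d" "b \<in> C" "c \<in> C"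
  shows "a * c \<approx> b * d"
proof -
  have "c * (a - b) + b * (c - d) \<in> I"
    using assms by (intro ideal_add ideal_mult) (simp_all add: eqv_def)
  then show ?thesis by (simp add: eqv_def algebra_simps)
qed

lemma prod_closed: "(\<And>x. x \<in> A \<Longrightarrow> f x \<in> C) \<Longrightarrow> prod f A \<in> C"
  by (induction A rule: infinite_finite_induct) (auto simp: one mult)

lemma eqv_prod:
  "(\<And>x. x \<in> A \<Longrightarrow> f x \<approx> g x \<and> f x \<in> C \<and> g x \<in> C) \<Longrightarrow> prod f A \<approx> prod g A"
  by (induction A rule: infinite_finite_induct) (auto intro!: eqv_refl eqv_mult prod_closed)

text \<open>The element \<open>(a * p - b * q) - b * (p - q)\<close> of the ideal equals
  \<open>(a - b) * p\<close>; multiplying by the inverse \<open>r\<close> of \<open>p\<close> leaves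
  \<open>a - b\<close>.\<close>

lemma eqv_cancel:
  assumes "a * p \<approx> b * q" "p \<approx> q" "p * r = 1" "b \<in> C" "r \<in> C"
  shows "a \<approx> b"
proof -
  have "r * ((a * p - b * q) + - (b * (p - q))) \<in> I"
    using assms by (intro ideal_add ideal_mult ideal_uminus) (simp_all add: eqv_def)
  also have "r * ((a * p - b * q) + - (b * (p - q))) = (a - b) * (p * r)"
    by (simp add: algebra_simps)
  finally show ?thesis by (simp add: eqv_def assms(3))
qed

text \<open>The uniqueness counterpart of \<open>triangular_solvable\<close>, modulo the ideal: the
  smaller system fixes the other pivots, and the last one follows by cancelling the remaining
  factors.\<close>

lemma triangular_unique:
  assumes "triangular S A piv"
    and "\<And>i x. i \<in> S \<Longrightarrow> x \<in> A i \<Longrightarrow> f x \<in> C \<and> g x \<in> C \<and> (\<exists>r\<in>C. f x * r = 1)"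
    and "\<And>i. i \<in> S \<Longrightarrow> (\<Prod>x\<in>A i. f x) \<approx> (\<Prod>x\<in>A i. g x)"
    and "\<And>i x. i \<in> S \<Longrightarrow> x \<in> A i - piv ` S \<Longrightarrow> f x \<approx> g x"
  shows "\<forall>i\<in>S. f (piv i) \<approx> g (piv i)"
proof -
  have "finite S" using assms(1) unfolding triangular_def by blast
  then show ?thesis
    using assms
  proof (induction S rule: finite_psubset_induct)
    case (psubset S)
    show ?case
    proof (cases "S = {}")
      case True
      then show ?thesis by simp
    next
      case False
      obtain i where i: "i \<in> S" "triangular (S - {i}) A piv"
          "\<And>j. j \<in> S - {i} \<Longrightarrow> piv i \<notin> A j"
        using triangular_obtain[OF psubset.prems(1) False] by blast
      have "S - {i} \<subset> S" using i(1) by blast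
      \<comment> \<open>Here \<open>piv i\<close> no longer counts as a pivot, but it does not occur
        in \<open>A j\<close>.\<close>
      moreover have "f x \<approx> g x" if "j \<in> S - {i}" "x \<in> A j - piv ` (S - {i})" for j x
        using psubset.prems(4)[of j x] that i(3)[OF that(1)] by auto
      ultimately have IH: "\<forall>j\<in>S - {i}. f (piv j) \<approx> g (piv j)"
        using psubset.prems(2,3) by (intro psubset.IH i(2)) blast+
      have A: "finite (A i)" "piv i \<in> A i"
        using psubset.prems(1) i(1) unfolding triangular_def by auto
      have fg: "f x \<in> C" "g x \<in> C" "\<exists>r\<in>C. f x * r = 1" if "x \<in> A i" for x
        using psubset.prems(2)[OF i(1) that] by auto
      have rest: "f x \<approx> g x" if "x \<in> A i - {piv i}" for x
        using IH psubset.prems(4)[OF i(1), of x] that by auto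
      obtain r where r: "\<And>x. x \<in> A i \<Longrightarrow> r x \<in> C \<and> f x * r x = 1"
        using fg(3) by metis
      have "f (piv i) \<approx> g (piv i)"
      proof (rule eqv_cancel)
        show "f (piv i) * (\<Prod>x\<in>A i - {piv i}. f x) \<approx> g (piv i) * (\<Prod>x\<in>A i - {piv i}. g x)"
          using psubset.prems(3)[OF i(1)] by (simp add: prod.remove[OF A])
        show "(\<Prod>x\<in>A i - {piv i}. f x) \<approx> (\<Prod>x\<in>A i - {piv i}. g x)"
          by (rule eqv_prod) (use rest fg in auto)
        show "(\<Prod>x\<in>A i - {piv i}. f x) * (\<Prod>x\<in>A i - {piv i}. r x) = 1"
          using r by (simp flip: prod.distrib)
        show "(\<Prod>x\<in>A i - {piv i}. r x) \<in> C" by (rule prod_closed) (use r in auto)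
        show "g (piv i) \<in> C" using fg(2) A(2) by blast
      qed
      then show ?thesis using IH by auto
    qed
  qed
qed

end

section \<open>Strata of the versal scheme\<close>

lemma laurent_ideal_congruence:
  assumes "ideal I (laurent_ring X U)"
  shows "ideal_congruence (carrier (laurent_ring X U)) I"
proof
  interpret ideal I "laurent_ring X U" by fact
  fix a b r :: "('a, 'b) laurent"
  show "0 \<in> I" using additive_subgroup.zero_closed[OF is_additive_subgroup] by simp
  show "a \<in> I \<Longrightarrow> b \<in> I \<Longrightarrow> a + b \<in> I" using additive_subgroup.a_closed[OF is_additive_subgroup] by simp
  show mult: "a \<in> I \<Longrightarrow> r \<in> carrier (laurent_ring X U) \<Longrightarrow> r * a \<in> I" for a r
    using I_l_closed by simp
  show "a \<in> I \<Longrightarrow> - a \<in> I" using mult[of a "- 1"] by (simp add: laurent_closed)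
qed (simp_all add: laurent_closed)

text \<open>The first isomorphism theorem. The target has no equations, so its ideal is zero and its
  cosets are singletons; the kernel of \<open>\<phi>\<close> is the defining ideal of
  \<open>Y\<close>.\<close>

lemma scheme_isomorphicI:
  fixes Y :: "('x, 'k::field) affine_scheme" and Z :: "('y, 'k) affine_scheme"
  assumes hom: "\<phi> \<in> ring_hom (ambient_ring Y) (ambient_ring Z)"
    and const: "\<And>c. \<phi> (const c) = const c"
    and free: "equations Z = {}"
    and eqs: "equations Y \<subseteq> carrier (ambient_ring Y)" "\<And>p. p \<in> equations Y \<Longrightarrow> \<phi> p = 0"
    and surj: "\<phi> ` carrier (ambient_ring Y) = carrier (ambient_ring Z)"
    and ker: "\<And>p. p \<in> carrier (ambient_ring Y) \<Longrightarrow> \<phi> p = 0 \<Longrightarrow> p \<in> defining_ideal Y"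
  shows "scheme_isomorphic Y Z"
proof -
  let ?R = "ambient_ring Y" and ?T = "ambient_ring Z" and ?I = "defining_ideal Y" and ?J = "defining_ideal Z"
  interpret R: cring ?R unfolding ambient_ring_def by (rule cring_laurent_ring)
  interpret T: cring ?T unfolding ambient_ring_def by (rule cring_laurent_ring)
  have zero: "\<zero>\<^bsub>?R\<^esub> = 0" "\<zero>\<^bsub>?T\<^esub> = 0" by (simp_all add: ambient_ring_def)
  have J: "?J = {0}"
  proof -
    have "?J \<subseteq> {\<zero>\<^bsub>?T\<^esub>}"
      unfolding defining_ideal_def free by (rule T.genideal_minimal[OF T.zeroideal]) simp
    moreover have "ideal ?J ?T"
      unfolding defining_ideal_def free by (rule T.genideal_ideal) simp
    then have "\<zero>\<^bsub>?T\<^esub> \<in> ?J" by (rule additive_subgroup.zero_closed[OF ideal.axioms(1)])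
    ultimately show ?thesis by (auto simp: zero)
  qed
  interpret J: ideal ?J ?T
    using T.zeroideal by (simp add: J zero)
  define h where "h p = ?J +>\<^bsub>?T\<^esub> \<phi> p" for p
  have "h \<in> ring_hom ?R (coordinate_ring Z)"
    using ring_hom_trans[OF hom J.rcos_ring_hom] unfolding coordinate_ring_def h_def comp_def .
  then interpret h: ring_hom_ring ?R "coordinate_ring Z" h
    using J.quotient_is_ring unfolding coordinate_ring_def
    by (intro ring_hom_ringI2 R.ring_axioms)
  have coset: "?J +>\<^bsub>?T\<^esub> q = {q}" for q
    unfolding J a_r_coset_def' by (simp add: ambient_ring_def)
  have "h ` carrier ?R = (\<lambda>q. ?J +>\<^bsub>?T\<^esub> q) ` carrier ?T"
    unfolding h_def surj[symmetric] by (simp add: image_image)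
  also have "\<dots> = carrier (coordinate_ring Z)"
    unfolding coordinate_ring_def FactRing_def A_RCOSETS_def' by auto
  finally have "(\<lambda>X. the_elem (h ` X)) \<in> ring_iso (?R Quot a_kernel ?R (coordinate_ring Z) h) (coordinate_ring Z)"
    by (rule h.FactRing_iso_set)
  moreover have kernel: "a_kernel ?R (coordinate_ring Z) h = ?I"
  proof
    have "\<zero>\<^bsub>coordinate_ring Z\<^esub> = {0}"
      unfolding coordinate_ring_def FactRing_def by (simp add: J)
    then have a_kernel: "a_kernel ?R (coordinate_ring Z) h = {p \<in> carrier ?R. \<phi> p = 0}"
      unfolding a_kernel_def' h_def coset by auto
    then show "a_kernel ?R (coordinate_ring Z) h \<subseteq> ?I" using ker by auto
    show "?I \<subseteq> a_kernel ?R (coordinate_ring Z) h"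
      unfolding defining_ideal_def
      by (rule R.genideal_minimal[OF h.kernel_is_ideal]) (use eqs a_kernel in auto)
  qed
  moreover have "the_elem (h ` structure_map Y c) = structure_map Z c" for c
  proof -
    have "const c \<in> carrier ?R" unfolding ambient_ring_def by (rule const_closed)
    then have "the_elem (h ` structure_map Y c) = h (const c)"
      unfolding structure_map_def kernel[symmetric] by (rule h.the_elem_simp)
    then show ?thesis unfolding h_def structure_map_def const .
  qed
  ultimately show ?thesis
    unfolding scheme_isomorphic_def coordinate_ring_def[of Y]
    by (intro bexI[of _ "\<lambda>X. the_elem (h ` X)"]) simp_all
qed

section \<open>The monomial conditions on a stratum and their pivots\<close>

text \<open>The variables of the monomial \<open>\<alpha>\<^sub>i \<Prod>\<^sub>j x\<^sub>j\<close>.\<close>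

definition star_vars :: "'v set \<Rightarrow> 'v set set \<Rightarrow> 'v set set \<Rightarrow> 'v \<Rightarrow> 'v tree_var set" where
  "star_vars V E M i = VarX ` neighbors V E i \<union> (if i \<in> \<Union>M then {} else {VarAlpha i})"

lemma prod_star_vars:
  assumes "finite V"
  shows "(\<Prod>x\<in>star_vars V E M i. var x) =
    (alpha M i * (\<Prod>j\<in>neighbors V E i. var (VarX j)) :: ('v tree_var, 'k::field) laurent)"
proof -
  have "finite (neighbors V E i)" using assms unfolding neighbors_def by simp
  moreover have "(\<Prod>x\<in>VarX ` neighbors V E i. var x :: ('v tree_var, 'k) laurent) =
      (\<Prod>j\<in>neighbors V E i. var (VarX j))"
    by (subst prod.reindex) (auto simp: inj_on_def)
  moreover have "VarAlpha i \<notin> VarX ` neighbors V E i" by blast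
  ultimately show ?thesis by (simp add: star_vars_def alpha_def)
qed

text \<open>A subsystem with an uncovered vertex \<open>i\<close> has the pivot
  \<open>VarAlpha i\<close>, which belongs to no other star. A fully covered one has a partner as
  pivot, by the walk argument.\<close>

lemma star_vars_triangular:
  assumes graph: "simple_graph V E" and acyclic: "\<nexists>p. graph_cycle E p"
    and M: "matching V E M" and S: "independent_set V E S"
  obtains piv where "triangular S (star_vars V E M) piv"
proof -
  have ME: "M \<subseteq> E" using M unfolding matching_def by blast
  have fin: "finite V" using graph unfolding simple_graph_def by blast
  have SV: "S \<subseteq> V" using S unfolding independent_set_def by blast
  obtain m where m: "\<And>v. v \<in> \<Union>M \<Longrightarrow> {v, m v} \<in> M" "\<And>v. v \<in> \<Union>M \<Longrightarrow> m (m v) = v"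
    using matching_partner[OF graph M] by blast
  define piv where "piv i = (if i \<in> \<Union>M then VarX (m i) else VarAlpha i)" for i
  have "triangular S (star_vars V E M) piv"
    unfolding triangular_def
  proof (intro conjI ballI allI impI)
    show "finite S" using SV fin finite_subset by blast
  next
    fix i assume "i \<in> S"
    show "finite (star_vars V E M i)" using fin unfolding star_vars_def neighbors_def by simp
    show "piv i \<in> star_vars V E M i"
    proof (cases "i \<in> \<Union>M")
      case True
      then have "{i, m i} \<in> E" using m(1) ME by blast
      then have "m i \<in> neighbors V E i"
        using graph_edge(2)[OF graph] unfolding neighbors_def by blast
      then show ?thesis using True by (simp add: piv_def star_vars_def)
    next
      case False
      then show ?thesis by (simp add: piv_def star_vars_def)
    qed
  next
    fix S' assume S': "S' \<subseteq> S" "S' \<noteq> {}"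
    show "\<exists>i\<in>S'. \<forall>j\<in>S'. piv i \<in> star_vars V E M j \<longrightarrow> j = i"
    proof (cases "S' \<subseteq> \<Union>M")
      case True
      have "independent_set V E S'" using S S'(1) unfolding independent_set_def by blast
      then obtain i where i: "i \<in> S'" "\<And>j. j \<in> S' \<Longrightarrow> {j, m i} \<in> E \<Longrightarrow> j = i"
        using matched_independent_set_has_pivot[OF graph acyclic M _ True S'(2) m] by blast
      have "j = i" if "j \<in> S'" "piv i \<in> star_vars V E M j" for j
      proof -
        have "m i \<in> neighbors V E j"
          using that(2) i(1) True by (auto simp: piv_def star_vars_def split: if_splits)
        then show ?thesis using i(2)[OF that(1)] unfolding neighbors_def by blast
      qed
      then show ?thesis using i(1) by blast
    next
      case False
      then obtain i where "i \<in> S'" "i \<notin> \<Union>M" by blast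
      then show ?thesis
        by (intro bexI[of _ i]) (auto simp: piv_def star_vars_def split: if_splits)
    qed
  qed
  then show thesis by (rule that)
qed

text \<open>Equal to the invertible variables of \<open>W_stratum V E M S\<close>.\<close>

definition stratum_units :: "'v set \<Rightarrow> 'v set set \<Rightarrow> 'v set \<Rightarrow> 'v tree_var set" where
  "stratum_units V M S = VarX ` (V - S) \<union> VarAlpha ` (V - \<Union>M)"

text \<open>Independence enters here: the neighbors of a vertex of \<open>S\<close> lie outside
  \<open>S\<close>, so their variables are invertible.\<close>

lemma star_vars_subset_units:
  assumes "independent_set V E S" "i \<in> S"
  shows "star_vars V E M i \<subseteq> stratum_units V M S"
  using assms unfolding star_vars_def stratum_units_def independent_set_def neighbors_def
  by (auto simp: subset_iff)

lemma card_stratum_units: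
  assumes "finite V" "S \<subseteq> V"
  shows "card (stratum_units V M S) = card V - card S + card (V - \<Union>M)"
proof -
  have "card (stratum_units V M S) = card (VarX ` (V - S)) + card (VarAlpha ` (V - \<Union>M))"
    unfolding stratum_units_def using assms(1) by (intro card_Un_disjoint) auto
  then show ?thesis
    using assms by (simp add: card_image inj_on_def card_Diff_subset finite_subset)
qed

lemma laurent_eval_diff: "laurent_eval F G (p - q) = laurent_eval F G p - laurent_eval F G q"
  using laurent_eval_add[of F G "p - q" q] by simp

section \<open>The isomorphism with a torus times an affine space\<close>

lemma W_stratum_isomorphic:
  fixes V :: "'v set"
  assumes graph: "simple_graph V E" and S: "independent_set V E S"
    and tri: "triangular S (star_vars V E M) piv"
    and \<beta>: "bij_betw \<beta> {..<n} (stratum_units V M S - piv ` S)"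
    and \<sigma>: "bij_betw \<sigma> {..<s} S"
  shows "scheme_isomorphic (W_stratum V E M S :: ('v tree_var, 'k::field) affine_scheme)
    (torus_times_affine n s)"
proof -
  let ?Y = "W_stratum V E M S :: ('v tree_var, 'k) affine_scheme"
  let ?Z = "torus_times_affine n s :: (nat + nat, 'k) affine_scheme"
  define A where "A = star_vars V E M"
  define D where "D = stratum_units V M S"
  define X where "X = VarX ` V \<union> VarX' ` V \<union> VarAlpha ` (V - \<Union>M)"
  define XZ :: "(nat + nat) set" where "XZ = Inl ` {..<n} \<union> Inr ` {..<s}"
  define UZ :: "(nat + nat) set" where "UZ = Inl ` {..<n}"
  define R :: "('v tree_var, 'k) laurent ring" where "R = laurent_ring X D"
  define T :: "(nat + nat, 'k) laurent ring" where "T = laurent_ring XZ UZ"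
  define I where "I = defining_ideal ?Y"
  have fin: "finite V" using graph unfolding simple_graph_def by blast
  have SV: "S \<subseteq> V" using S unfolding independent_set_def by blast
  have DX: "D \<subseteq> X" by (auto simp: D_def X_def stratum_units_def)
  have AD: "A i \<subseteq> D" if "i \<in> S" for i
    unfolding A_def D_def by (rule star_vars_subset_units[OF S that])
  have AX: "A i \<subseteq> X" if "i \<in> V" for i
    using that by (auto simp: A_def star_vars_def X_def neighbors_def)
  note tri = tri[folded A_def] and \<beta> = \<beta>[folded D_def]
  have pivD: "piv i \<in> D" if "i \<in> S" for i
    using tri AD that unfolding triangular_def by blast
  have R: "ambient_ring ?Y = R"
    by (simp add: ambient_ring_def W_stratum_def stratum_def X_versal_def R_def X_def D_def
      stratum_units_def Un_commute)
  have T: "ambient_ring ?Z = T"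
    by (simp add: ambient_ring_def torus_times_affine_def T_def XZ_def UZ_def)
  have eqs: "equations ?Y = {var (VarX i) * var (VarX' i) - (1 + (\<Prod>x\<in>A i. var x)) | i. i \<in> V} \<union>
      var ` VarX ` S"
    by (simp add: W_stratum_def stratum_def X_versal_def A_def prod_star_vars[OF fin])
  have var_R: "var x \<in> carrier R" if "x \<in> X" for x
    unfolding R_def by (rule var_closed[OF that])
  have var_T: "var x \<in> carrier T" if "x \<in> XZ" for x
    unfolding T_def by (rule var_closed[OF that])
  have closed_R: "const c \<in> carrier R" "0 \<in> carrier R" "1 \<in> carrier R"
      "p \<in> carrier R \<Longrightarrow> q \<in> carrier R \<Longrightarrow> p + q \<in> carrier R"
      "p \<in> carrier R \<Longrightarrow> q \<in> carrier R \<Longrightarrow> p * q \<in> carrier R"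
      "p \<in> carrier R \<Longrightarrow> - p \<in> carrier R"
      "(\<And>x. x \<in> B \<Longrightarrow> g x \<in> carrier R) \<Longrightarrow> prod g B \<in> carrier R"
    for c p q g and B :: "'v tree_var set"
    unfolding R_def by (blast intro: laurent_closed)+
  have closed_T: "const c \<in> carrier T" "0 \<in> carrier T" "1 \<in> carrier T"
      "p \<in> carrier T \<Longrightarrow> q \<in> carrier T \<Longrightarrow> p + q \<in> carrier T"
      "p \<in> carrier T \<Longrightarrow> q \<in> carrier T \<Longrightarrow> p * q \<in> carrier T"
      "p \<in> carrier T \<Longrightarrow> - p \<in> carrier T"
      "(\<And>x. x \<in> B \<Longrightarrow> g x \<in> carrier T) \<Longrightarrow> prod g B \<in> carrier T"
    for c p q g and B :: "'v tree_var set"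
    unfolding T_def by (blast intro: laurent_closed)+
  have diff_R: "p - q \<in> carrier R" if "p \<in> carrier R" "q \<in> carrier R" for p q
    using closed_R(4)[OF that(1) closed_R(6)[OF that(2)]] by simp
  have prod_R: "(\<Prod>x\<in>A i. var x) \<in> carrier R" if "i \<in> V" for i
    using AX[OF that] by (intro closed_R var_R) auto
  have eqs_R: "equations ?Y \<subseteq> carrier R"
    using SV unfolding eqs by (auto intro!: diff_R closed_R prod_R var_R simp: X_def)
  interpret Rr: cring R unfolding R_def by (rule cring_laurent_ring)
  have idl: "ideal I R" and eqs_I: "equations ?Y \<subseteq> I"
    unfolding I_def defining_ideal_def R
    using Rr.genideal_ideal[OF eqs_R] Rr.genideal_self[OF eqs_R] by auto
  interpret ideal_congruence "carrier R" I
    using laurent_ideal_congruence idl unfolding R_def .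
  write eqv (infix "\<approx>" 50)
  have rel: "var (VarX i) * var (VarX' i) \<approx> 1 + (\<Prod>x\<in>A i. var x)" if "i \<in> V" for i
    using eqs_I that unfolding eqs eqv_def by blast
  have zero: "var (VarX i) \<approx> 0" if "i \<in> S" for i
    using eqs_I that unfolding eqs eqv_def by auto
  \<comment> \<open>Since \<open>VarX i\<close> vanishes modulo \<open>I\<close>, the equation of
    \<open>i\<close> reduces to a condition on the monomial.\<close>
  have star: "(\<Prod>x\<in>A i. var x) \<approx> - 1" if i: "i \<in> S" for i
  proof -
    have "0 * var (VarX' i) \<approx> var (VarX i) * var (VarX' i)"
      using i SV by (intro eqv_mult eqv_sym[OF zero] eqv_refl var_R) (auto simp: X_def)
    also have "\<dots> \<approx> 1 + (\<Prod>x\<in>A i. var x)" using rel i SV by blast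
    finally have "0 \<approx> 1 + (\<Prod>x\<in>A i. var x)" by simp
    from eqv_sym[OF this] show ?thesis by (simp add: eqv_def add.commute)
  qed

  define \<beta>' where "\<beta>' = inv_into {..<n} \<beta>"
  define \<sigma>' where "\<sigma>' = inv_into {..<s} \<sigma>"
  have \<beta>D: "\<beta> k \<in> D - piv ` S" "\<beta>' (\<beta> k) = k" if "k < n" for k
    using that bij_betwE[OF \<beta>] bij_betw_inv_into_left[OF \<beta>] unfolding \<beta>'_def by auto
  have \<beta>': "\<beta>' x < n" "\<beta> (\<beta>' x) = x" if "x \<in> D - piv ` S" for x
    using bij_betwE[OF bij_betw_inv_into[OF \<beta>]] bij_betw_inv_into_right[OF \<beta>] that
    unfolding \<beta>'_def by auto
  have \<sigma>S: "\<sigma> k \<in> S" "\<sigma>' (\<sigma> k) = k" if "k < s" for k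
    using that bij_betwE[OF \<sigma>] bij_betw_inv_into_left[OF \<sigma>] unfolding \<sigma>'_def by auto
  have \<beta>X: "\<beta> k \<in> X" if "k < n" for k using \<beta>D(1)[OF that] DX by blast
  have \<sigma>X: "VarX' (\<sigma> k) \<in> X" if "k < s" for k using \<sigma>S(1)[OF that] SV by (auto simp: X_def)
  have \<sigma>': "\<sigma>' i < s" "\<sigma> (\<sigma>' i) = i" if "i \<in> S" for i
    using bij_betwE[OF bij_betw_inv_into[OF \<sigma>]] bij_betw_inv_into_right[OF \<sigma>] that
    unfolding \<sigma>'_def by auto

  define units where "units = {a \<in> carrier T. \<exists>b\<in>carrier T. a * b = 1}"
  \<comment> \<open>The free units become torus coordinates. The default 1 only has to be a unit:
    pivots receive their values from the system, and variables outside \<open>D\<close> are reset in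
    \<open>F0\<close>.\<close>
  define f0 :: "'v tree_var \<Rightarrow> (nat + nat, 'k) laurent" where
    "f0 x = (if x \<in> D - piv ` S then var (Inl (\<beta>' x)) else 1)" for x
  obtain f where f: "\<And>x. f x \<in> units" "\<And>x. x \<notin> piv ` S \<Longrightarrow> f x = f0 x"
      "\<And>i. i \<in> S \<Longrightarrow> (\<Prod>x\<in>A i. f x) = - 1"
  proof (rule triangular_solvable[OF tri, of units f0 "- 1"])
    show "1 \<in> units" using closed_T unfolding units_def by auto
    show "- 1 \<in> units" using closed_T unfolding units_def by (auto intro!: bexI[of _ "- 1"])
    show "\<exists>b\<in>units. a * b = 1" if "a \<in> units" for a
      using that unfolding units_def by (auto simp: mult.commute)
    show "f0 x \<in> units" for x
    proof (cases "x \<in> D - piv ` S")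
      case True
      then have "\<beta>' x < n" by (rule \<beta>')
      then have "var (Inl (\<beta>' x)) \<in> carrier T" "ivar (Inl (\<beta>' x)) \<in> carrier T"
        unfolding T_def XZ_def UZ_def by (auto intro!: var_closed ivar_closed)
      then show ?thesis using True unfolding f0_def units_def
        by (auto intro!: bexI[of _ "ivar (Inl (\<beta>' x))"] simp: var_mult_ivar)
    next
      case False
      then show ?thesis using \<open>1 \<in> units\<close> unfolding f0_def by auto
    qed
    show "a * b \<in> units" if "a \<in> units" "b \<in> units" for a b
    proof -
      obtain a' b' where *: "a' \<in> carrier T" "b' \<in> carrier T" "a * a' = 1" "b * b' = 1"
        using \<open>a \<in> units\<close> \<open>b \<in> units\<close> unfolding units_def by blast
      have "a * b * (a' * b') = (a * a') * (b * b')" by (simp add: ac_simps)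
      then have "a * b * (a' * b') = 1" using * by simp
      then show ?thesis
        using *(1,2) that closed_T unfolding units_def by blast
    qed
  qed (rule that)
  have "\<exists>b\<in>carrier T. f x * b = 1" for x using f(1) unfolding units_def by blast
  then obtain f' where f': "\<And>x. f' x \<in> carrier T" "\<And>x. f x * f' x = 1" by metis
  have f_T: "f x \<in> carrier T" for x using f(1) unfolding units_def by blast

  define F0 where "F0 x = (if x \<in> D then f x else 0)" for x
  \<comment> \<open>For \<open>i \<in> S\<close> the variable \<open>VarX' i\<close> becomes an
    affine coordinate; for other \<open>i\<close> the equation is solved for it, with
    \<open>f' (VarX i)\<close> as the inverse of the value of \<open>VarX i\<close>.\<close>
  define F where "F x = (case x of
      VarX' i \<Rightarrow> if i \<in> S then var (Inr (\<sigma>' i)) else f' (VarX i) * (1 + (\<Prod>y\<in>A i. F0 y))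
    | _ \<Rightarrow> F0 x)" for x
  define \<phi> where "\<phi> = laurent_eval F f'"
  have F_D: "F x = f x" if "x \<in> D" for x
    using that by (auto simp: F_def F0_def D_def stratum_units_def)
  have F_X0: "F (VarX i) = 0" if "i \<in> S" for i
    using that by (auto simp: F_def F0_def D_def stratum_units_def)
  have F_A: "F x = F0 x" if "x \<in> A i" for x i
    using that by (auto simp: F_def A_def star_vars_def split: if_splits)
  have F_T: "F x \<in> carrier T" for x
  proof -
    have F0_T: "F0 x \<in> carrier T" for x using f_T closed_T by (simp add: F0_def)
    have "var (Inr (\<sigma>' i)) \<in> carrier T" if "i \<in> S" for i
      using \<sigma>' that by (intro var_T) (auto simp: XZ_def)
    then show ?thesis
      using F0_T unfolding F_def by (cases x) (auto intro!: closed_T f')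
  qed
  have \<phi>_units: "F x * f' x = 1" if "x \<in> D" for x using F_D f' that by simp
  have \<phi>_hom: "\<phi> \<in> ring_hom R T"
    unfolding \<phi>_def R_def T_def
    by (rule laurent_eval_hom) (use \<phi>_units F_T f'(1) in \<open>auto simp: T_def\<close>)
  have \<phi>_T: "\<phi> p \<in> carrier T" if "p \<in> carrier R" for p
    using ring_hom_closed[OF \<phi>_hom that] .
  have \<phi>_mult: "\<phi> (p * q) = \<phi> p * \<phi> q" if "p \<in> carrier R" "q \<in> carrier R" for p q
    unfolding \<phi>_def
    by (rule laurent_eval_mult[where X = X and U = D]) (use that \<phi>_units in \<open>simp_all add: R_def\<close>)
  have \<phi>_prod: "\<phi> (\<Prod>x\<in>A i. var x) = (\<Prod>x\<in>A i. F0 x)" if "i \<in> V" for i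
  proof -
    have "\<phi> (\<Prod>x\<in>A i. var x) = (\<Prod>x\<in>A i. \<phi> (var x))"
      unfolding \<phi>_def using \<phi>_units AX[OF that]
      by (intro laurent_eval_prod[where X = X and U = D] var_closed) auto
    then show ?thesis using F_A by (simp add: \<phi>_def)
  qed
  have F0_prod: "(\<Prod>x\<in>A i. F0 x) = - 1" if "i \<in> S" for i
    using AD[OF that] f(3)[OF that] by (simp add: F0_def subset_iff cong: prod.cong)

  define G :: "nat + nat \<Rightarrow> ('v tree_var, 'k) laurent" where
    "G = case_sum (\<lambda>k. var (\<beta> k)) (\<lambda>k. var (VarX' (\<sigma> k)))"
  \<comment> \<open>The value 0 is a dummy, since the affine coordinates are not inverted.\<close>
  define G' :: "nat + nat \<Rightarrow> ('v tree_var, 'k) laurent" where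
    "G' = case_sum (\<lambda>k. ivar (\<beta> k)) (\<lambda>k. 0)"
  define \<psi> where "\<psi> = laurent_eval G G'"
  have \<psi>_units: "G x * G' x = 1" if "x \<in> UZ" for x
    using that var_mult_ivar by (auto simp: G_def G'_def UZ_def)
  have \<psi>_hom: "\<psi> \<in> ring_hom T R"
    unfolding \<psi>_def R_def T_def
  proof (rule laurent_eval_hom)
    fix x assume x: "x \<in> XZ"
    then show "G x \<in> carrier (laurent_ring X D)"
      by (auto simp: XZ_def G_def intro!: var_closed \<beta>X \<sigma>X)
    show "G' x \<in> carrier (laurent_ring X D)" if "x \<in> UZ"
      using that \<beta>D(1) by (auto simp: UZ_def G'_def intro!: ivar_closed \<beta>X)
  qed (rule \<psi>_units)
  have \<psi>_R: "\<psi> q \<in> carrier R" if "q \<in> carrier T" for q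
    using ring_hom_closed[OF \<psi>_hom that] .
  have \<psi>_mult: "\<psi> (p * q) = \<psi> p * \<psi> q" if "p \<in> carrier T" "q \<in> carrier T" for p q
    unfolding \<psi>_def
    by (rule laurent_eval_mult[where X = XZ and U = UZ]) (use that \<psi>_units in \<open>simp_all add: T_def\<close>)
  have \<psi>_prod: "\<psi> (\<Prod>x\<in>B. g x) = (\<Prod>x\<in>B. \<psi> (g x))" if "\<And>x. x \<in> B \<Longrightarrow> g x \<in> carrier T"
    for B :: "'v tree_var set" and g
    unfolding \<psi>_def
    using \<psi>_units that by (intro laurent_eval_prod[where X = XZ and U = UZ]) (auto simp: T_def)
  have \<psi>_f: "\<psi> (f x) * \<psi> (f' x) = 1" for x
    using \<psi>_mult[OF f_T f'(1), of x x] f'(2)[of x] by (simp add: \<psi>_def)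

  \<comment> \<open>This is an honest equality, checked on generators; the reverse composition is
    the identity only modulo \<open>I\<close>.\<close>
  have \<phi>\<psi>: "\<phi> (\<psi> q) = q" if "q \<in> carrier T" for q
  proof -
    have "q \<in> carrier (laurent_ring XZ UZ)" using that by (simp add: T_def)
    then have "q \<in> carrier T \<and> \<phi> (\<psi> q) = q"
    proof (induction q rule: laurent_ring_induct)
      case (const c)
      then show ?case by (simp add: \<psi>_def \<phi>_def closed_T)
    next
      case (var x)
      have f_\<beta>: "f (\<beta> k) = var (Inl k)" if "k < n" for k
        using \<beta>D[OF that] f(2) by (simp add: f0_def)
      have "\<phi> (G x) = var x"
        using var \<beta>D \<sigma>S f_\<beta> F_D
        by (auto simp: XZ_def G_def \<phi>_def F_def[of "VarX' _"])
      then show ?case using var_T[OF var] by (simp add: \<psi>_def)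
    next
      case (ivar x)
      then obtain k where k: "x = Inl k" "k < n" by (auto simp: UZ_def)
      have inv: "var x * f' (\<beta> k) = 1"
        using f'(2)[of "\<beta> k"] \<beta>D[OF k(2)] f(2) by (simp add: f0_def k(1))
      have "f' (\<beta> k) = (var x * ivar x) * f' (\<beta> k)" by (simp add: var_mult_ivar)
      also have "\<dots> = ivar x * (var x * f' (\<beta> k))" by (simp add: ac_simps)
      finally have "\<phi> (G' x) = ivar x" using inv by (simp add: G'_def \<phi>_def k(1))
      moreover have "ivar x \<in> carrier T" unfolding T_def by (rule ivar_closed[OF ivar])
      ultimately show ?case by (simp add: \<psi>_def)
    next
      case (add p q)
      then show ?case by (simp add: \<psi>_def \<phi>_def laurent_eval_add closed_T)
    next
      case (mult p q)
      then show ?case by (simp add: \<psi>_mult \<phi>_mult \<psi>_R closed_T)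
    qed
    then show ?thesis by blast
  qed

  \<comment> \<open>Away from the pivots \<open>\<psi>\<close> undoes \<open>f\<close> exactly. At
    the pivots, both sides solve the same triangular system modulo \<open>I\<close>.\<close>
  have unit_var: "\<psi> (F x) \<approx> var x" if x: "x \<in> D" for x
  proof -
    have base: "\<psi> (f x) \<approx> var x" if "x \<in> D - piv ` S" for x
      using \<beta>'[OF that] that f(2) by (simp add: f0_def \<psi>_def G_def eqv_refl)
    have "\<forall>i\<in>S. \<psi> (f (piv i)) \<approx> var (piv i)"
    proof (rule triangular_unique[OF tri])
      fix i assume i: "i \<in> S"
      show "\<psi> (f x) \<approx> var x" if "x \<in> A i - piv ` S" for x
        using base AD[OF i] that by blast
      show "\<psi> (f x) \<in> carrier R \<and> var x \<in> carrier R \<and> (\<exists>r\<in>carrier R. \<psi> (f x) * r = 1)"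
        if "x \<in> A i" for x
        using \<psi>_f \<psi>_R f_T f'(1) var_R AX[of i] i SV that by blast
      have "(\<Prod>x\<in>A i. \<psi> (f x)) = \<psi> (- 1)"
        using f(3)[OF i] f_T by (simp flip: \<psi>_prod)
      also have "\<psi> (- 1) = - 1"
        using laurent_eval_diff[of G G' 0 1] by (simp add: \<psi>_def)
      finally show "(\<Prod>x\<in>A i. \<psi> (f x)) \<approx> (\<Prod>x\<in>A i. var x)"
        using eqv_sym[OF star[OF i]] by simp
    qed
    then show ?thesis using base F_D[OF x] x by auto
  qed
  have X_var: "\<psi> (F x) \<approx> var x" if x: "x \<in> X" for x
  proof (cases "x \<in> D")
    case True
    then show ?thesis by (rule unit_var)
  next
    case False
    then consider i where "x = VarX i" "i \<in> S" | i where "x = VarX' i" "i \<in> S"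
      | i where "x = VarX' i" "i \<in> V - S"
      using x by (auto simp: X_def D_def stratum_units_def)
    then show ?thesis
    proof cases
      case 1
      then show ?thesis using eqv_sym[OF zero] by (simp add: F_X0 \<psi>_def)
    next
      case 2
      then show ?thesis using \<sigma>' by (simp add: F_def \<psi>_def G_def eqv_refl)
    next
      case 3
      have D: "VarX i \<in> D" using 3 by (auto simp: D_def stratum_units_def)
      have A: "F0 y \<in> carrier T \<and> \<psi> (F0 y) \<approx> var y" if y: "y \<in> A i" for y
      proof (cases "y \<in> D")
        case True
        then show ?thesis using unit_var F_A[OF y] F_T by metis
      next
        \<comment> \<open>The star of a vertex outside \<open>S\<close> may contain
          \<open>VarX j\<close> with \<open>j \<in> S\<close>; it is sent to 0, to which it is
          congruent.\<close>
        case False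
        then obtain j where "y = VarX j" "j \<in> S"
          using y AX[of i] 3 by (auto simp: A_def star_vars_def X_def D_def stratum_units_def neighbors_def split: if_splits)
        then show ?thesis using zero eqv_sym False closed_T by (simp add: F0_def \<psi>_def)
      qed
      \<comment> \<open>Multiplying by the unit \<open>\<psi> (f (VarX i))\<close>, congruent to
        \<open>VarX i\<close>, recovers the equation of \<open>i\<close>; the unit is cancelled at
        the end.\<close>
      have "\<psi> (F x) * \<psi> (f (VarX i)) = \<psi> (F x * f (VarX i))"
        by (rule \<psi>_mult[OF F_T f_T, symmetric])
      also have "F x * f (VarX i) = (1 + (\<Prod>y\<in>A i. F0 y)) * (f (VarX i) * f' (VarX i))"
        using 3 by (simp add: F_def ac_simps)
      also have "\<psi> \<dots> = 1 + (\<Prod>y\<in>A i. \<psi> (F0 y))"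
        using A by (simp add: f'(2) \<psi>_def laurent_eval_add \<psi>_prod[unfolded \<psi>_def])
      finally have "\<psi> (F x) * \<psi> (f (VarX i)) = 1 + (\<Prod>y\<in>A i. \<psi> (F0 y))" .
      also have "\<dots> \<approx> 1 + (\<Prod>y\<in>A i. var y)"
        using A AX[of i] 3 var_R \<psi>_R by (intro eqv_add eqv_refl eqv_prod) blast
      also have "\<dots> \<approx> var x * var (VarX i)"
        using eqv_sym[OF rel[of i]] 3 by (simp add: mult.commute)
      finally have "\<psi> (F x) * \<psi> (f (VarX i)) \<approx> var x * var (VarX i)" .
      moreover have "\<psi> (f (VarX i)) \<approx> var (VarX i)" using unit_var[OF D] F_D[OF D] by simp
      ultimately show ?thesis
        by (rule eqv_cancel[OF _ _ \<psi>_f]) (use var_R x \<psi>_R f'(1) in auto)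
    qed
  qed
  have \<psi>\<phi>: "\<psi> (\<phi> p) \<approx> p" if "p \<in> carrier R" for p
  proof -
    have "p \<in> carrier (laurent_ring X D)" using that by (simp add: R_def)
    then have "p \<in> carrier R \<and> \<psi> (\<phi> p) \<approx> p"
    proof (induction p rule: laurent_ring_induct)
      case (const c)
      then show ?case by (simp add: \<psi>_def \<phi>_def closed_R eqv_refl)
    next
      case (var x)
      then show ?case using X_var var_R by (simp add: \<phi>_def)
    next
      case (ivar x)
      have ivar_R: "ivar x \<in> carrier R" unfolding R_def by (rule ivar_closed[OF ivar])
      have "\<psi> (f' x) * \<psi> (f x) = ivar x * var x"
        unfolding mult.commute[of "ivar x"] mult.commute[of "\<psi> (f' x)"] \<psi>_f var_mult_ivar ..
      then have *: "\<psi> (f' x) * \<psi> (f x) \<approx> ivar x * var x" by (simp add: eqv_refl)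
      \<comment> \<open>Inverses of congruent units are congruent.\<close>
      have "\<psi> (f' x) \<approx> ivar x"
        by (rule eqv_cancel[OF * _ \<psi>_f])
          (use unit_var[OF ivar(2)] F_D[OF ivar(2)] ivar_R \<psi>_R f' in auto)
      then show ?case using ivar_R by (simp add: \<phi>_def)
    next
      case (add p q)
      then show ?case
        by (auto simp: \<psi>_def \<phi>_def laurent_eval_add intro!: closed_R eqv_add)
    next
      case (mult p q)
      then show ?case
        using \<phi>_T \<psi>_R by (auto simp: \<phi>_mult \<psi>_mult intro!: closed_R eqv_mult)
    qed
    then show ?thesis by blast
  qed

  show ?thesis
  proof (rule scheme_isomorphicI)
    show "\<phi> \<in> ring_hom (ambient_ring ?Y) (ambient_ring ?Z)" using \<phi>_hom by (simp add: R T)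
    show "\<phi> (const c) = const c" for c by (simp add: \<phi>_def)
    show "equations ?Z = {}" by (simp add: torus_times_affine_def)
    show "equations ?Y \<subseteq> carrier (ambient_ring ?Y)" using eqs_R by (simp add: R)
    show "\<phi> ` carrier (ambient_ring ?Y) = carrier (ambient_ring ?Z)"
      unfolding R T using \<phi>_T \<psi>_R \<phi>\<psi> by (metis (no_types, lifting) image_eqI image_subset_iff subsetI subset_antisym)
    show "p \<in> defining_ideal ?Y" if "p \<in> carrier (ambient_ring ?Y)" "\<phi> p = 0" for p
    proof -
      have "\<psi> 0 \<approx> p" using \<psi>\<phi>[of p] that by (simp add: R)
      then have "0 \<approx> p" by (simp add: \<psi>_def)
      from eqv_sym[OF this] show ?thesis by (simp add: eqv_def flip: I_def)
    qed
    show "\<phi> p = 0" if p: "p \<in> equations ?Y" for p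
    proof -
      consider i where "i \<in> V" "p = var (VarX i) * var (VarX' i) - (1 + (\<Prod>x\<in>A i. var x))"
        | i where "i \<in> S" "p = var (VarX i)"
        using p unfolding eqs by blast
      then show ?thesis
      proof cases
        case 1
        have "\<phi> (var (VarX i) * var (VarX' i)) = F (VarX i) * F (VarX' i)"
          using 1 by (subst \<phi>_mult) (auto simp: \<phi>_def X_def intro!: var_R)
        moreover have "\<phi> (1 + (\<Prod>x\<in>A i. var x)) = 1 + (\<Prod>x\<in>A i. F0 x)"
          using \<phi>_prod[of i] 1 by (simp add: \<phi>_def laurent_eval_add)
        moreover have "F (VarX i) * F (VarX' i) = 1 + (\<Prod>x\<in>A i. F0 x)"
        \<comment> \<open>For \<open>i \<in> S\<close> both sides are 0, the monomial being sent to
          \<open>- 1\<close>.\<close>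
        proof (cases "i \<in> S")
          case True
          then show ?thesis by (simp add: F_X0 F0_prod)
        next
          case False
          then have "VarX i \<in> D" using 1 by (auto simp: D_def stratum_units_def)
          then have "F (VarX i) * F (VarX' i) = (f (VarX i) * f' (VarX i)) * (1 + (\<Prod>x\<in>A i. F0 x))"
            using False F_D by (simp add: F_def[of "VarX' i"] mult.assoc)
          then show ?thesis by (simp add: f'(2))
        qed
        ultimately show ?thesis using 1 by (simp add: \<phi>_def laurent_eval_diff)
      next
        case 2
        then show ?thesis by (simp add: \<phi>_def F_X0)
      qed
    qed
  qed
qed

text \<open>The first conjunct ensures that \<open>nat\<close> does not truncate the
  exponent.\<close>

theorem proposition4p16:
  fixes V :: "'v set" and E M :: "'v set set" and S :: "'v set"
    and t s :: nat
  assumes "tree V E" and "card V = t"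
    and "max_matching V E M"
    and "independent_set V E S" and "card S = s"
  shows "0 \<le> int t + tree_dim V E - 2 * int s \<and>
    scheme_isomorphic
      (W_stratum V E M S :: ('v tree_var, 'k::field) affine_scheme)
      (torus_times_affine (nat (int t + tree_dim V E - 2 * int s)) s)"
proof -
  have graph: "simple_graph V E" and acyclic: "\<nexists>p. graph_cycle E p"
    using assms(1) unfolding tree_def by auto
  have M: "matching V E M" using assms(3) unfolding max_matching_def by blast
  have fin: "finite V" using graph unfolding simple_graph_def by blast
  have SV: "S \<subseteq> V" using assms(4) unfolding independent_set_def by blast
  then have finS: "finite S" using fin finite_subset by blast
  obtain piv where tri: "triangular S (star_vars V E M) piv"
    using star_vars_triangular[OF graph acyclic M assms(4)] by blast
  let ?D = "stratum_units V M S"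
  have piv: "piv ` S \<subseteq> ?D"
    using tri star_vars_subset_units[OF assms(4)] unfolding triangular_def by blast
  have finD: "finite ?D" using fin unfolding stratum_units_def by simp
  have "card (piv ` S) = s"
    using card_image[OF triangular_inj[OF tri]] assms(5) by simp
  \<comment> \<open>The \<open>s\<close> pivots are distinct units, so removing them lowers the
    count by \<open>s\<close>. The inequality keeps the truncated subtraction exact.\<close>
  then have "card (?D - piv ` S) = t - s + card (V - \<Union>M) - s" "s \<le> t - s + card (V - \<Union>M)"
    using card_Diff_subset[OF _ piv] card_mono[OF finD piv] finS
      card_stratum_units[OF fin SV, of M] assms(2,5) by simp_all
  moreover have "s \<le> t" using card_mono[OF fin SV] assms(2,5) by simp
  ultimately have card: "int (card (?D - piv ` S)) = int t + tree_dim V E - 2 * int s"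
    unfolding tree_dim_eq_card_uncovered[OF graph acyclic assms(3)] by linarith
  obtain \<beta> where \<beta>: "bij_betw \<beta> {..<card (?D - piv ` S)} (?D - piv ` S)"
    using ex_bij_betw_nat_finite[of "?D - piv ` S"] finD by (auto simp: atLeast0LessThan)
  obtain \<sigma> where \<sigma>: "bij_betw \<sigma> {..<s} S"
    using ex_bij_betw_nat_finite[OF finS] assms(5) by (auto simp: atLeast0LessThan)
  have "0 \<le> int t + tree_dim V E - 2 * int s" "nat (int t + tree_dim V E - 2 * int s) = card (?D - piv ` S)"
    using card by linarith+
  then show ?thesis
    using W_stratum_isomorphic[OF graph assms(4) tri \<beta> \<sigma>] by simp
qed

end
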